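(* Suppose $\mathcal{M}=(\Omega,\mathcal{F},\mu)$ and $\mathcal{N}=(\Omega,\mathcal{G},\nu)$ are two hyperfinite probability spaces that are Loeb equivalent to each other. Let $\mathcal{H}$ be the hyperfinite algebra generated by $\mathcal{F}\cup\mathcal{G}$. Then there is an internal probability measure $P$ on $\mathcal{H}$ such that $\mathcal{M}$ is Loeb equivalent to $(\Omega,\mathcal{H},P)$.
   Context: We work in an $\aleph_1$-saturated nonstandard universe; $\mathsf{st}$ denotes the standard part map. An internal probability space $(\Omega,\mathcal{F},\mu)$ consists of an internal set $\Omega$, an internal algebra $\mathcal{F}$ of (internal) subsets of $\Omega$, and an internal probability measure $\mu:\mathcal{F}\to{}^*[0,1]$, i.e. an internal finitely additive function with $\mu(\Omega)=1$. It is called hyperfinite if $\mathcal{F}$ is hyperfinite ($\Omega$ itself need not be hyperfinite). The Loeb extension of $(\Omega,\mathcal{F},\mu)$ is the countably additive probability space $(\Omega,\overline{\mathcal{F}},\overline{\mu})$, where $\overline{\mathcal{F}}$ is the collection of all sets $B\subset\Omega$ (not necessarily internal) such that $\sup\{\mathsf{st}(\mu(A)): A\in\mathcal{F}, A\subset B\}=\inf\{\mathsf{st}(\mu(C)): C\in\mathcal{F}, B\subset C\}$, and $\overline{\mu}(B)$ is this common value. Two internal probability spaces $(\Omega,\mathcal{F},\mu)$ and $(\Omega,\mathcal{G},\nu)$ are Loeb equivalent if $\overline{\mathcal{F}}=\overline{\mathcal{G}}$ and $\overline{\mu}=\overline{\nu}$. The algebra generated by $\mathcal{F}\cup\mathcal{G}$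 means the smallest internal algebra of subsets of $\Omega$ containing $\mathcal{F}\cup\mathcal{G}$; it is hyperfinite when $\mathcal{F}$ and $\mathcal{G}$ are. *)

theory Defs
  imports "HOL-Analysis.Sigma_Algebra"
begin

text \<open>
  A membership relation \<open>E\<close> and the set \<open>X\<close> of its atoms are parameters of the following,
  so that the same definitions serve the standard and the nonstandard side.
\<close>

definition elts :: "('v \<Rightarrow> 'v \<Rightarrow> bool) \<Rightarrow> 'v \<Rightarrow> 'v set" where
  "elts E a = {x. E x a}"

definition code :: "('v \<Rightarrow> 'v \<Rightarrow> bool) \<Rightarrow> 'v set \<Rightarrow> 'v set \<Rightarrow> 'v" where
  "code E X A = (THE a. a \<notin> X \<and> elts E a = A)"

definition kpair :: "('v \<Rightarrow> 'v \<Rightarrow> bool) \<Rightarrow> 'v set \<Rightarrow> 'v \<Rightarrow> 'v \<Rightarrow> 'v" where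
  "kpair E X x y = code E X {code E X {x}, code E X {x, y}}"

primrec level :: "('v \<Rightarrow> 'v \<Rightarrow> bool) \<Rightarrow> 'v set \<Rightarrow> nat \<Rightarrow> 'v set" where
  "level E X 0 = X"
| "level E X (Suc n) = level E X n \<union> {a. a \<notin> X \<and> elts E a \<subseteq> level E X n}"

text \<open>
  \<open>full\<close> makes \<open>level E X (Suc n)\<close> a copy of $V_n(X) \cup \mathcal{P}(V_n(X))$, and
  \<open>exhaust\<close> says that \<open>'v\<close> is the union of the levels, so these axioms determine
  $V(X) = \bigcup_n V_n(X)$ up to isomorphism.
\<close>

locale superstructure =
  fixes E :: "'v \<Rightarrow> 'v \<Rightarrow> bool" and X :: "'v set"
  assumes atoms_empty: "x \<in> X \<Longrightarrow> elts E x = {}"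
    and extensional: "a \<notin> X \<Longrightarrow> b \<notin> X \<Longrightarrow> elts E a = elts E b \<Longrightarrow> a = b"
    and full: "A \<subseteq> level E X n \<Longrightarrow> \<exists>a. a \<notin> X \<and> elts E a = A"
    and exhaust: "\<exists>n. a \<in> level E X n"

text \<open>
  Bounded formulas of the language of membership; \<open>BEx i j \<phi>\<close> is
  $\exists x_i \in x_j.\ \phi$. Constants are supplied by the assignment.
\<close>

datatype formula =
    Mem nat nat
  | Eq nat nat
  | Neg formula
  | Conj formula formula
  | BEx nat nat formula

primrec sat :: "('v \<Rightarrow> 'v \<Rightarrow> bool) \<Rightarrow> formula \<Rightarrow> (nat \<Rightarrow> 'v) \<Rightarrow> bool" where
  "sat E (Mem i j) s \<longleftrightarrow> E (s i) (s j)"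
| "sat E (Eq i j) s \<longleftrightarrow> s i = s j"
| "sat E (Neg \<phi>) s \<longleftrightarrow> \<not> sat E \<phi> s"
| "sat E (Conj \<phi> \<psi>) s \<longleftrightarrow> sat E \<phi> s \<and> sat E \<psi> s"
| "sat E (BEx i j \<phi>) s \<longleftrightarrow> (\<exists>x. E x (s j) \<and> sat E \<phi> (s(i := x)))"

text \<open>
  \<open>'v\<close> is the standard superstructure, whose atoms include a copy of the reals. \<open>'w\<close> is the
  collection of internal objects, with \<open>imem\<close> the membership relation between them;
  arbitrary (possibly external) sets of internal objects are HOL sets of type \<open>'w set\<close>.
  Since every internal object lies in the extension of a standard set, \<open>'w\<close> with \<open>imem\<close> is
  isomorphic to a transitive part of the superstructure over the nonstandard atoms.
\<close>

record ('v, 'w) nonstandard_data =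
  mem :: "'v \<Rightarrow> 'v \<Rightarrow> bool"
  atoms :: "'v set"
  re :: "real \<Rightarrow> 'v"
  imem :: "'w \<Rightarrow> 'w \<Rightarrow> bool"
  star :: "'v \<Rightarrow> 'w"

locale nonstandard_universe =
  fixes U :: "('v, 'w) nonstandard_data"
  assumes standard: "superstructure (mem U) (atoms U)"
    and re_inj: "inj (re U)"
    and re_atom: "range (re U) \<subseteq> atoms U"
    and transfer: "sat (mem U) \<phi> s \<longleftrightarrow> sat (imem U) \<phi> (star U \<circ> s)"
    and all_internal: "\<exists>v. imem U w (star U v)"

text \<open>
  Saturation for countable families of internal sets. It implies that the extension is
  proper: consider the sets of hypernaturals greater than \<open>n\<close>, for \<open>n\<close> standard.
\<close>

locale aleph1_saturated_universe = nonstandard_universe U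
  for U :: "('v, 'w) nonstandard_data" +
  assumes saturated: "(\<And>n::nat. (\<Inter>k\<le>n. elts (imem U) (A k)) \<noteq> {}) \<Longrightarrow>
    (\<Inter>n. elts (imem U) (A n)) \<noteq> {}"


abbreviation scode :: "('v, 'w) nonstandard_data \<Rightarrow> 'v set \<Rightarrow> 'v" where
  "scode U \<equiv> code (mem U) (atoms U)"

abbreviation spair :: "('v, 'w) nonstandard_data \<Rightarrow> 'v \<Rightarrow> 'v \<Rightarrow> 'v" where
  "spair U \<equiv> kpair (mem U) (atoms U)"

definition iatoms :: "('v, 'w) nonstandard_data \<Rightarrow> 'w set" where
  "iatoms U = elts (imem U) (star U (scode U (atoms U)))"

abbreviation icode :: "('v, 'w) nonstandard_data \<Rightarrow> 'w set \<Rightarrow> 'w" where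
  "icode U \<equiv> code (imem U) (iatoms U)"

abbreviation ipair :: "('v, 'w) nonstandard_data \<Rightarrow> 'w \<Rightarrow> 'w \<Rightarrow> 'w" where
  "ipair U \<equiv> kpair (imem U) (iatoms U)"

definition hyperreals :: "('v, 'w) nonstandard_data \<Rightarrow> 'w set" where
  "hyperreals U = elts (imem U) (star U (scode U (range (re U))))"

definition hreal :: "('v, 'w) nonstandard_data \<Rightarrow> real \<Rightarrow> 'w" where
  "hreal U r = star U (re U r)"

definition hle :: "('v, 'w) nonstandard_data \<Rightarrow> 'w \<Rightarrow> 'w \<Rightarrow> bool" where
  "hle U x y \<longleftrightarrow>
    imem U (ipair U x y) (star U (scode U {spair U (re U r) (re U s) | r s. r \<le> s}))"

definition hadd :: "('v, 'w) nonstandard_data \<Rightarrow> 'w \<Rightarrow> 'w \<Rightarrow> 'w" where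
  "hadd U x y = (THE z. imem U (ipair U (ipair U x y) z)
    (star U (scode U {spair U (spair U (re U r) (re U s)) (re U (r + s)) | r s. True})))"

text \<open>Meaningful for finite \<open>x\<close>: the real number infinitely close to \<open>x\<close>.\<close>

definition st :: "('v, 'w) nonstandard_data \<Rightarrow> 'w \<Rightarrow> real" where
  "st U x = (THE r. \<forall>e>0. hle U (hreal U (r - e)) x \<and> hle U x (hreal U (r + e)))"


definition internal :: "('v, 'w) nonstandard_data \<Rightarrow> 'w set \<Rightarrow> bool" where
  "internal U S \<longleftrightarrow> (\<exists>a. a \<notin> iatoms U \<and> S = elts (imem U) a)"

text \<open>Hyperfinite sets are the elements of ${}^*\mathcal{P}_{\mathrm{fin}}(V_n(X))$.\<close>

definition hyperfinite :: "('v, 'w) nonstandard_data \<Rightarrow> 'w set \<Rightarrow> bool" where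
  "hyperfinite U S \<longleftrightarrow> (\<exists>n a.
    imem U a (star U (scode U {scode U A | A. finite A \<and> A \<subseteq> level (mem U) (atoms U) n}))
    \<and> S = elts (imem U) a)"

text \<open>
  A family of internal sets has type \<open>'w set set\<close>; it is an internal object when the set of
  the codes of its members is internal. Likewise an internal function \<open>\<mu>\<close> on \<open>\<F>\<close>
  is one whose graph on \<open>\<F>\<close> is internal; its values outside \<open>\<F>\<close> are irrelevant.
\<close>

definition internal_algebra ::
    "('v, 'w) nonstandard_data \<Rightarrow> 'w set \<Rightarrow> 'w set set \<Rightarrow> bool" where
  "internal_algebra U \<Omega> \<F> \<longleftrightarrow>
    internal U \<Omega> \<and> (\<forall>A\<in>\<F>. internal U A) \<and> internal U (icode U ` \<F>) \<and> algebra \<Omega> \<F>"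

definition internal_probability ::
    "('v, 'w) nonstandard_data \<Rightarrow> 'w set \<Rightarrow> 'w set set \<Rightarrow> ('w set \<Rightarrow> 'w) \<Rightarrow> bool" where
  "internal_probability U \<Omega> \<F> \<mu> \<longleftrightarrow>
    internal U {ipair U (icode U A) (\<mu> A) | A. A \<in> \<F>} \<and>
    (\<forall>A\<in>\<F>. \<mu> A \<in> hyperreals U \<and> hle U (hreal U 0) (\<mu> A) \<and> hle U (\<mu> A) (hreal U 1)) \<and>
    \<mu> \<Omega> = hreal U 1 \<and>
    (\<forall>A\<in>\<F>. \<forall>B\<in>\<F>. A \<inter> B = {} \<longrightarrow> \<mu> (A \<union> B) = hadd U (\<mu> A) (\<mu> B))"

definition internal_prob_space ::
    "('v, 'w) nonstandard_data \<Rightarrow> 'w set \<Rightarrow> 'w set set \<Rightarrow> ('w set \<Rightarrow> 'w) \<Rightarrow> bool" where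
  "internal_prob_space U \<Omega> \<F> \<mu> \<longleftrightarrow>
    internal_algebra U \<Omega> \<F> \<and> internal_probability U \<Omega> \<F> \<mu>"

definition hyperfinite_prob_space ::
    "('v, 'w) nonstandard_data \<Rightarrow> 'w set \<Rightarrow> 'w set set \<Rightarrow> ('w set \<Rightarrow> 'w) \<Rightarrow> bool" where
  "hyperfinite_prob_space U \<Omega> \<F> \<mu> \<longleftrightarrow>
    internal_prob_space U \<Omega> \<F> \<mu> \<and> hyperfinite U (icode U ` \<F>)"

text \<open>
  When a smallest internal algebra containing \<open>\<S>\<close> exists, it is the following intersection;
  in general the intersection need not be internal.
\<close>

definition generated_internal_algebra ::
    "('v, 'w) nonstandard_data \<Rightarrow> 'w set \<Rightarrow> 'w set set \<Rightarrow> 'w set set" where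
  "generated_internal_algebra U \<Omega> \<S> = \<Inter>{\<K>. internal_algebra U \<Omega> \<K> \<and> \<S> \<subseteq> \<K>}"


definition loeb_inner ::
    "('v, 'w) nonstandard_data \<Rightarrow> 'w set set \<Rightarrow> ('w set \<Rightarrow> 'w) \<Rightarrow> 'w set \<Rightarrow> real" where
  "loeb_inner U \<F> \<mu> B = (SUP A\<in>{A\<in>\<F>. A \<subseteq> B}. st U (\<mu> A))"

definition loeb_outer ::
    "('v, 'w) nonstandard_data \<Rightarrow> 'w set set \<Rightarrow> ('w set \<Rightarrow> 'w) \<Rightarrow> 'w set \<Rightarrow> real" where
  "loeb_outer U \<F> \<mu> B = (INF C\<in>{C\<in>\<F>. B \<subseteq> C}. st U (\<mu> C))"

definition loeb_sets ::
    "('v, 'w) nonstandard_data \<Rightarrow> 'w set \<Rightarrow> 'w set set \<Rightarrow> ('w set \<Rightarrow> 'w) \<Rightarrow> 'w set set" where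
  "loeb_sets U \<Omega> \<F> \<mu> = {B. B \<subseteq> \<Omega> \<and> loeb_inner U \<F> \<mu> B = loeb_outer U \<F> \<mu> B}"

definition loeb_equivalent ::
    "('v, 'w) nonstandard_data \<Rightarrow> 'w set \<Rightarrow> 'w set set \<Rightarrow> ('w set \<Rightarrow> 'w) \<Rightarrow>
      'w set set \<Rightarrow> ('w set \<Rightarrow> 'w) \<Rightarrow> bool" where
  "loeb_equivalent U \<Omega> \<F> \<mu> \<G> \<nu> \<longleftrightarrow>
    loeb_sets U \<Omega> \<F> \<mu> = loeb_sets U \<Omega> \<G> \<nu> \<and>
    (\<forall>B\<in>loeb_sets U \<Omega> \<F> \<mu>. loeb_inner U \<F> \<mu> B = loeb_inner U \<G> \<nu> B)"

end

theory Submission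
  imports Defs
begin

text \<open>
  Loeb equivalence forces the two algebras to be the same away from one set of infinitesimal
  measure. Each \<open>A \<in> \<F>\<close> is Loeb measurable for \<open>\<nu>\<close>, so for every standard \<open>\<epsilon> > 0\<close> it is squeezed
  between two sets of \<open>\<G>\<close> whose difference has \<open>\<nu>\<close>-measure at most \<open>\<epsilon>\<close>. Say that \<open>A\<close> splits an
  atom \<open>b\<close> of \<open>\<G>\<close> if \<open>b\<close> meets both \<open>A\<close> and its complement. The atoms split by a fixed \<open>A\<close> all lie
  in the gap between the two sets, so their total measure is at most \<open>\<epsilon>\<close>. On the other hand an
  atom that is split by at least one member of \<open>\<F>\<close> is split by at least half of them
  (\<open>half_split\<close>). Averaging over \<open>A \<in> \<F>\<close> bounds the measure of the union \<open>N\<close> of all atoms split by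
  some member of \<open>\<F>\<close> by \<open>2\<epsilon>\<close> (\<open>measure_split_union_le\<close>). As \<open>N\<close> does not depend on \<open>\<epsilon>\<close>, its
  measure is infinitesimal.

  Outside \<open>N\<close> every atom of \<open>\<G>\<close> is contained in or disjoint from each member of \<open>\<F>\<close>. Hence the
  sets \<open>C\<close> with \<open>C - N \<in> \<G>\<close> form an algebra that contains \<open>\<F>\<close> and \<open>\<G>\<close>, and so contains \<open>\<H>\<close>.
  Fix a point \<open>x \<in> \<Omega>\<close> and let \<open>T C\<close> be \<open>C \<union> N\<close> or \<open>C - N\<close>, according to whether \<open>x \<in> C\<close>.
  Then \<open>T\<close> is a homomorphism of Boolean algebras from \<open>\<H>\<close> to \<open>\<G>\<close>, so \<open>P C = \<nu> (T C)\<close>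
  inherits additivity from \<open>\<nu>\<close> and is an internal probability measure on \<open>\<H>\<close>. A set has the
  same inner and the same outer measure for \<open>P\<close> as for \<open>\<nu>\<close>, because approximating sets from \<open>\<H>\<close>
  turn into approximating sets from \<open>\<G>\<close> when \<open>N\<close> is removed from or added to them
  (\<open>loeb_equal_modulo_null\<close>).

  The combinatorial part is a statement about finite algebras and a real-valued
  measure. It is expressed by one bounded formula, \<open>merge_formula\<close>, whose
  truth is proved in the standard superstructure (\<open>standard_merge\<close>) and then transferred
  (\<open>internal_merge\<close>); this yields the codes of \<open>\<H>\<close> and of \<open>N\<close> at the same time. The Loeb
  measures then depend only on the standard parts of \<open>\<nu>\<close> and \<open>P\<close>, which are ordinary finitely
  additive probabilities.
\<close>

section \<open>Atoms of a finite algebra split by another one\<close>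

definition splits :: "'a set \<Rightarrow> 'a set \<Rightarrow> bool" where
  "splits A b \<longleftrightarrow> b \<inter> A \<noteq> {} \<and> b - A \<noteq> {}"

locale two_finite_algebras =
  F: algebra \<Omega> F + G: algebra \<Omega> G for \<Omega> :: "'a set" and F G +
  assumes finite_F: "finite F" and finite_G: "finite G"
begin

text \<open>
  In a finite algebra the intersection of all members through a point is itself a member, hence the
  atom containing the point.
\<close>
definition atom_at :: "'a \<Rightarrow> 'a set" where
  "atom_at x = \<Inter>{A \<in> G. x \<in> A}"

definition atoms_G :: "'a set set" where
  "atoms_G = atom_at ` \<Omega>"

definition split_union :: "'a set" where
  "split_union = \<Union>{b \<in> atoms_G. \<exists>A\<in>F. splits A b}"

lemma atom_at_in:
  assumes "x \<in> \<Omega>" shows "atom_at x \<in> G"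
proof -
  have "{A \<in> G. x \<in> A} \<noteq> {}" using assms G.top by blast
  then have "(\<Inter>A\<in>{A \<in> G. x \<in> A}. A) \<in> G"
    using finite_G by (intro G.finite_INT) simp_all
  then show ?thesis by (simp add: atom_at_def)
qed

lemma atom_at_self: "x \<in> atom_at x"
  by (simp add: atom_at_def)

lemma atom_at_eq:
  assumes "x \<in> \<Omega>" "y \<in> atom_at x"
  shows "atom_at y = atom_at x"
proof -
  have "x \<in> A \<longleftrightarrow> y \<in> A" if "A \<in> G" for A
  proof
    assume "x \<in> A"
    then show "y \<in> A" using assms(2) that unfolding atom_at_def by blast
  next
    assume "y \<in> A"
    then show "x \<in> A" using assms G.compl_sets[OF that] unfolding atom_at_def by blast
  qed
  then have "{A \<in> G. y \<in> A} = {A \<in> G. x \<in> A}" by blast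
  then show ?thesis by (simp add: atom_at_def)
qed

lemma atoms_G_subset: "atoms_G \<subseteq> G"
  by (auto simp: atoms_G_def atom_at_in)

lemma finite_atoms_G: "finite atoms_G"
  using finite_subset[OF atoms_G_subset finite_G] .

lemma atoms_disjoint: "disjoint_family_on (\<lambda>b. b) atoms_G"
proof -
  have "atom_at x = atom_at y" if "x \<in> \<Omega>" "y \<in> \<Omega>" "z \<in> atom_at x" "z \<in> atom_at y" for x y z
    using atom_at_eq[OF that(1,3)] atom_at_eq[OF that(2,4)] by simp
  then show ?thesis unfolding disjoint_family_on_def atoms_G_def by blast
qed

lemma atom_dichotomy:
  assumes "b \<in> atoms_G" "A \<in> G" shows "b \<subseteq> A \<or> b \<inter> A = {}"
proof -
  obtain x where x: "x \<in> \<Omega>" "b = atom_at x" using assms(1) by (auto simp: atoms_G_def)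
  have "b \<subseteq> A" if "y \<in> b" "y \<in> A" for y
  proof -
    have "b = atom_at y" using atom_at_eq[OF x(1)] that x(2) by simp
    then show ?thesis using that(2) assms(2) unfolding atom_at_def by blast
  qed
  then show ?thesis by blast
qed

lemma Union_atoms_in: "B \<subseteq> atoms_G \<Longrightarrow> \<Union>B \<in> G"
  using G.finite_Union[OF finite_subset[OF _ finite_atoms_G]] atoms_G_subset by simp

lemma split_union_in: "split_union \<in> G"
  unfolding split_union_def by (rule Union_atoms_in) auto

text \<open>
  An atom outside the exceptional set is not split by \<open>A\<close>, so it lies in \<open>A\<close> as soon as it
  meets \<open>A\<close>. What remains of \<open>A\<close> is therefore a union of atoms.
\<close>
lemma F_minus_split_union:
  assumes "A \<in> F" shows "A - split_union \<in> G"
proof -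
  have "A - split_union = \<Union>{b \<in> atoms_G. b \<subseteq> A - split_union}" (is "_ = ?R")
  proof
    show "A - split_union \<subseteq> ?R"
    proof
      fix x assume x: "x \<in> A - split_union"
      then have xO: "x \<in> \<Omega>" using assms F.sets_into_space by auto
      define b where "b = atom_at x"
      have b: "b \<in> atoms_G" "x \<in> b" using xO by (auto simp: atoms_G_def atom_at_self b_def)
      have "\<not> splits A' b" if "A' \<in> F" for A'
        using x b that by (auto simp: split_union_def)
      then have "b \<subseteq> A" using assms b x by (auto simp: splits_def)
      moreover have "b \<inter> split_union = {}"
        using atom_dichotomy[OF b(1) split_union_in] x b by auto
      ultimately show "x \<in> ?R" using b by auto
    qed
  qed auto
  then show ?thesis using Union_atoms_in[of "{b \<in> atoms_G. b \<subseteq> A - split_union}"] by auto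
qed

lemma algebra_modulo_split_union: "algebra \<Omega> {C. C \<subseteq> \<Omega> \<and> C - split_union \<in> G}"
proof -
  have "\<Omega> - C - split_union \<in> G" if "C - split_union \<in> G" for C
  proof -
    have "\<Omega> - C - split_union = (\<Omega> - (C - split_union)) - split_union" by auto
    then show ?thesis
      using G.Diff[OF G.compl_sets[OF that] split_union_in] by simp
  qed
  moreover have "C \<union> D - split_union = (C - split_union) \<union> (D - split_union)" for C D by auto
  ultimately show ?thesis by (auto simp: algebra_iff_Un)
qed

text \<open>
  The hypothesis holds for all members of the generated algebra, whose explicit
  description by atoms is thereby avoided.
\<close>
lemma generated_minus_split_union:
  assumes "\<And>K. algebra \<Omega> K \<Longrightarrow> F \<union> G \<subseteq> K \<Longrightarrow> C \<in> K"
  shows "C - split_union \<in> G"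
proof -
  have "F \<union> G \<subseteq> {C. C \<subseteq> \<Omega> \<and> C - split_union \<in> G}"
    using F_minus_split_union split_union_in F.sets_into_space G.sets_into_space by auto
  then show ?thesis using assms[OF algebra_modulo_split_union] by auto
qed

text \<open>
  If \<open>a\<close> splits \<open>b\<close> but \<open>A\<close> does not, then \<open>b\<close> is inside or outside \<open>A\<close>, and the symmetric
  difference of \<open>A\<close> and \<open>a\<close> does split \<open>b\<close>. So symmetric difference with \<open>a\<close> injects the
  members of \<open>F\<close> that do not split \<open>b\<close> into those that do.
\<close>
lemma half_split:
  assumes "a \<in> F" "splits a b"
  shows "card F \<le> 2 * card {A \<in> F. splits A b}"
proof -
  let ?S = "{A \<in> F. splits A b}"
  have "inj_on (\<lambda>A. (A - a) \<union> (a - A)) (F - ?S)"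
    by (rule inj_onI) blast
  moreover have "(\<lambda>A. (A - a) \<union> (a - A)) ` (F - ?S) \<subseteq> ?S"
  proof
    fix B assume "B \<in> (\<lambda>A. (A - a) \<union> (a - A)) ` (F - ?S)"
    then obtain A where A: "A \<in> F" "\<not> splits A b" "B = (A - a) \<union> (a - A)" by auto
    have "B \<in> F" using A assms by auto
    moreover have "splits B b"
      using A(2,3) assms(2) unfolding splits_def by blast
    ultimately show "B \<in> ?S" by simp
  qed
  ultimately have "card (F - ?S) \<le> card ?S"
    using finite_F by (intro card_inj_on_le) auto
  moreover have "card (F - ?S) = card F - card ?S"
    using finite_F by (intro card_Diff_subset) auto
  ultimately show ?thesis by linarith
qed

context
  fixes \<nu> :: "'a set \<Rightarrow> real"
  assumes nonneg: "A \<in> G \<Longrightarrow> 0 \<le> \<nu> A"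
    and add: "A \<in> G \<Longrightarrow> B \<in> G \<Longrightarrow> A \<inter> B = {} \<Longrightarrow> \<nu> (A \<union> B) = \<nu> A + \<nu> B"
begin

lemma measure_mono: "A \<in> G \<Longrightarrow> B \<in> G \<Longrightarrow> A \<subseteq> B \<Longrightarrow> \<nu> A \<le> \<nu> B"
  using add[of A "B - A"] nonneg[of "B - A"] G.Diff[of B A]
  by (simp add: Un_absorb1)

lemma measure_Union_atoms:
  assumes "B \<subseteq> atoms_G" shows "\<nu> (\<Union>B) = (\<Sum>b\<in>B. \<nu> b)"
proof -
  have "finite B" using assms finite_atoms_G finite_subset by blast
  then show ?thesis using assms
  proof (induction B)
    case empty
    then show ?case using add[of "{}" "{}"] by simp
  next
    case (insert b B)
    have "b \<inter> c = {}" if "c \<in> B" for c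
    proof -
      have "b \<noteq> c" "b \<in> atoms_G" "c \<in> atoms_G" using insert that by auto
      then show ?thesis using atoms_disjoint unfolding disjoint_family_on_def by blast
    qed
    then have "b \<inter> \<Union>B = {}" by blast
    moreover have "b \<in> G" using insert.prems atoms_G_subset by auto
    moreover have "\<Union>B \<in> G" using insert.prems Union_atoms_in by auto
    ultimately show ?case using insert add by simp
  qed
qed

text \<open>
  Double counting of the pairs of a set \<open>A \<in> F\<close> and an atom \<open>b\<close> split by it, weighted by
  \<open>\<nu> b\<close>. Summed over \<open>b\<close> first, each \<open>A\<close> contributes at most \<open>e\<close>; summed over \<open>A\<close>
  first, each atom in the union contributes at least half of \<open>card F\<close> times its measure.
\<close>
lemma measure_split_union_le:
  assumes approx: "\<And>A. A \<in> F \<Longrightarrow> \<exists>B\<in>G. \<exists>B'\<in>G. B \<subseteq> A \<and> A \<subseteq> B' \<and> \<nu> (B' - B) \<le> e"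
  shows "\<nu> split_union \<le> 2 * e"
proof -
  let ?bad = "{b \<in> atoms_G. \<exists>A\<in>F. splits A b}"
  have le: "(\<Sum>b | b \<in> atoms_G \<and> splits A b. \<nu> b) \<le> e" if "A \<in> F" for A
  proof -
    obtain B B' where B: "B \<in> G" "B' \<in> G" "B \<subseteq> A" "A \<subseteq> B'" "\<nu> (B' - B) \<le> e"
      using approx[OF \<open>A \<in> F\<close>] by blast
    have "b \<subseteq> B' - B" if "b \<in> atoms_G" "splits A b" for b
      using atom_dichotomy[OF that(1) B(1)] atom_dichotomy[OF that(1) B(2)] that(2) B(3,4)
      unfolding splits_def by blast
    then have "\<Union>{b \<in> atoms_G. splits A b} \<subseteq> B' - B" by auto
    then have "\<nu> (\<Union>{b \<in> atoms_G. splits A b}) \<le> \<nu> (B' - B)"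
      using B Union_atoms_in by (intro measure_mono) auto
    then show ?thesis using measure_Union_atoms[of "{b \<in> atoms_G. splits A b}"] B(5) by simp
  qed
  have "card F * \<nu> split_union = (\<Sum>b\<in>?bad. card F * \<nu> b)"
    unfolding split_union_def by (subst measure_Union_atoms) (auto simp: sum_distrib_left)
  also have "\<dots> \<le> (\<Sum>b\<in>?bad. 2 * (card {A \<in> F. splits A b} * \<nu> b))"
  proof (rule sum_mono)
    fix b assume b: "b \<in> ?bad"
    then have "card F \<le> 2 * card {A \<in> F. splits A b}" using half_split by blast
    then have "real (card F) \<le> 2 * real (card {A \<in> F. splits A b})" by linarith
    moreover have "0 \<le> \<nu> b" using b atoms_G_subset nonneg by auto
    ultimately have "card F * \<nu> b \<le> (2 * real (card {A \<in> F. splits A b})) * \<nu> b"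
      by (rule mult_right_mono)
    then show "card F * \<nu> b \<le> 2 * (card {A \<in> F. splits A b} * \<nu> b)" by (simp add: mult.assoc)
  qed
  also have "\<dots> = 2 * (\<Sum>b\<in>?bad. \<Sum>A | A \<in> F \<and> splits A b. \<nu> b)"
    by (simp add: sum_distrib_left)
  also have "\<dots> = 2 * (\<Sum>b\<in>atoms_G. \<Sum>A | A \<in> F \<and> splits A b. \<nu> b)"
    by (intro arg_cong[where f = "(*) 2"] sum.mono_neutral_left finite_atoms_G) (auto simp: card_gt_0_iff)
  also have "\<dots> = 2 * (\<Sum>A\<in>F. \<Sum>b | b \<in> atoms_G \<and> splits A b. \<nu> b)"
    by (rule arg_cong[where f = "(*) 2"], rule sum.swap_restrict[OF finite_atoms_G finite_F])
  also have "\<dots> \<le> 2 * (\<Sum>A\<in>F. e)"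
    using le by (intro mult_left_mono sum_mono) auto
  finally have "card F * \<nu> split_union \<le> card F * (2 * e)" by simp
  moreover have "0 < card F" using finite_F F.top by (auto simp: card_gt_0_iff)
  ultimately show ?thesis by (simp add: mult_le_cancel_left)
qed

end

end

text \<open>
  The points of \<open>\<Omega>\<close> have finitely many types, a type being the set of members of \<open>S\<close> that contain
  the point. The sets defined by conditions on the type form a finite algebra that contains
  \<open>S\<close>, which bounds the size of the smallest one.
\<close>
lemma finite_generated_algebra:
  assumes "finite S" "S \<subseteq> Pow \<Omega>"
  shows "\<exists>H. algebra \<Omega> H \<and> finite H \<and> S \<subseteq> H \<and> (\<forall>K. algebra \<Omega> K \<longrightarrow> S \<subseteq> K \<longrightarrow> H \<subseteq> K)"
proof -
  define type where "type x = {A \<in> S. x \<in> A}" for x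
  define D where "D = (\<lambda>T. {x \<in> \<Omega>. type x \<in> T}) ` Pow (Pow S)"
  have "algebra \<Omega> D"
    unfolding algebra_iff_Un
  proof (intro conjI ballI)
    show "D \<subseteq> Pow \<Omega>" by (auto simp: D_def)
    show "{} \<in> D" unfolding D_def by (rule image_eqI[of _ _ "{}"]) auto
    fix A assume "A \<in> D"
    then obtain T where T: "T \<subseteq> Pow S" "A = {x \<in> \<Omega>. type x \<in> T}" by (auto simp: D_def)
    show "\<Omega> - A \<in> D"
      unfolding D_def by (rule image_eqI[of _ _ "Pow S - T"]) (use T in \<open>auto simp: type_def\<close>)
    fix B assume "B \<in> D"
    then obtain T' where T': "T' \<subseteq> Pow S" "B = {x \<in> \<Omega>. type x \<in> T'}" by (auto simp: D_def)
    show "A \<union> B \<in> D"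
      unfolding D_def by (rule image_eqI[of _ _ "T \<union> T'"]) (use T T' in auto)
  qed
  moreover have "S \<subseteq> D"
  proof
    fix A assume A: "A \<in> S"
    show "A \<in> D" unfolding D_def
      by (rule image_eqI[of _ _ "{T. T \<subseteq> S \<and> A \<in> T}"]) (use A assms in \<open>auto simp: type_def\<close>)
  qed
  moreover have "finite D" unfolding D_def using assms by simp
  moreover define H where "H = \<Inter>{K. algebra \<Omega> K \<and> S \<subseteq> K}"
  moreover have "algebra \<Omega> H"
    unfolding algebra_iff_Un
  proof (intro conjI ballI)
    show "H \<subseteq> Pow \<Omega>" using \<open>algebra \<Omega> D\<close> \<open>S \<subseteq> D\<close> unfolding H_def D_def by blast
  qed (auto simp: H_def algebra_iff_Un)
  ultimately have "algebra \<Omega> H \<and> finite H \<and> S \<subseteq> H \<and> (\<forall>K. algebra \<Omega> K \<longrightarrow> S \<subseteq> K \<longrightarrow> H \<subseteq> K)"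
    by (auto intro: finite_subset[of H D])
  then show ?thesis ..
qed

section \<open>Bounded formulas about sets and ordered pairs\<close>

text \<open>
  The bound variables of the following formulas are the successor of the sum of the free
  ones (or come right after it). Being fresh for every choice of the free variables, they
  leave the evaluation lemmas free of side conditions.
\<close>

definition fAll :: "nat \<Rightarrow> nat \<Rightarrow> formula \<Rightarrow> formula" where
  "fAll i j \<phi> = Neg (BEx i j (Neg \<phi>))"
definition fImp :: "formula \<Rightarrow> formula \<Rightarrow> formula" where
  "fImp \<phi> \<psi> = Neg (Conj \<phi> (Neg \<psi>))"
definition fDisj :: "formula \<Rightarrow> formula \<Rightarrow> formula" where
  "fDisj \<phi> \<psi> = Neg (Conj (Neg \<phi>) (Neg \<psi>))"
definition fSubset :: "nat \<Rightarrow> nat \<Rightarrow> formula" where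
  "fSubset i j = (let x = Suc (i + j) in fAll x i (Mem x j))"
definition fUnion :: "nat \<Rightarrow> nat \<Rightarrow> nat \<Rightarrow> formula" where
  "fUnion k i j = (let x = Suc (k + i + j) in
    Conj (fAll x k (fDisj (Mem x i) (Mem x j))) (Conj (fSubset i k) (fSubset j k)))"
definition fDiff :: "nat \<Rightarrow> nat \<Rightarrow> nat \<Rightarrow> formula" where
  "fDiff k i j = (let x = Suc (k + i + j) in
    Conj (fAll x k (Conj (Mem x i) (Neg (Mem x j)))) (fAll x i (fDisj (Mem x j) (Mem x k))))"
definition fDisjoint :: "nat \<Rightarrow> nat \<Rightarrow> formula" where
  "fDisjoint i j = (let x = Suc (i + j) in fAll x i (Neg (Mem x j)))"
definition fDoubleton :: "nat \<Rightarrow> nat \<Rightarrow> nat \<Rightarrow> formula" where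
  "fDoubleton k i j = (let x = Suc (k + i + j) in
    Conj (Mem i k) (Conj (Mem j k) (fAll x k (fDisj (Eq x i) (Eq x j)))))"
definition fPair :: "nat \<Rightarrow> nat \<Rightarrow> nat \<Rightarrow> nat \<Rightarrow> formula" where
  "fPair X p i j = (let c = Suc (X + p + i + j); d = Suc c in
    Conj (Neg (Mem p X)) (BEx c p (BEx d p (Conj (fDoubleton p c d)
      (Conj (Conj (Neg (Mem c X)) (Neg (Mem d X)))
        (Conj (fDoubleton c i i) (fDoubleton d i j)))))))"
definition fPairMem :: "nat \<Rightarrow> nat \<Rightarrow> nat \<Rightarrow> nat \<Rightarrow> formula" where
  "fPairMem X n i j = (let p = Suc (X + n + i + j) in BEx p n (fPair X p i j))"
text \<open>
  States that $((x_i, x_j), x_k)$ belongs to $x_n$. The inner pair is reached by a bounded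
  quantifier because it is an element of an element of the outer one.
\<close>
definition fTripleMem :: "nat \<Rightarrow> nat \<Rightarrow> nat \<Rightarrow> nat \<Rightarrow> nat \<Rightarrow> formula" where
  "fTripleMem X n i j k = (let p = Suc (X + n + i + j + k); c = Suc p; q = Suc c in
    BEx p n (BEx c p (BEx q c (Conj (fPair X q i j) (fPair X p q k)))))"
definition fAlgebra :: "nat \<Rightarrow> nat \<Rightarrow> nat \<Rightarrow> formula" where
  "fAlgebra X w h = (let a = Suc (X + w + h); b = Suc a; c = Suc b in
    Conj (Mem w h) (Conj
      (fAll a h (Conj (Neg (Mem a X)) (Conj (fSubset a w) (BEx c h (fDiff c w a)))))
      (fAll a h (fAll b h (BEx c h (fUnion c a b))))))"

lemma sat_Mem: "sat E (Mem i j) s \<longleftrightarrow> s i \<in> elts E (s j)"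
  by (simp add: elts_def)

lemma sat_BEx: "sat E (BEx i j \<phi>) s \<longleftrightarrow> (\<exists>x\<in>elts E (s j). sat E \<phi> (s(i := x)))"
  by (auto simp: elts_def)

declare sat.simps(1,5) [simp del]
declare sat_Mem [simp] sat_BEx [simp]

lemma sat_fAll [simp]:
  "sat E (fAll i j \<phi>) s \<longleftrightarrow> (\<forall>x\<in>elts E (s j). sat E \<phi> (s(i := x)))"
  by (simp add: fAll_def)

lemma sat_fImp [simp]: "sat E (fImp \<phi> \<psi>) s \<longleftrightarrow> (sat E \<phi> s \<longrightarrow> sat E \<psi> s)"
  by (simp add: fImp_def)

lemma sat_fDisj [simp]: "sat E (fDisj \<phi> \<psi>) s \<longleftrightarrow> sat E \<phi> s \<or> sat E \<psi> s"
  by (auto simp: fDisj_def)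

lemma sat_fSubset [simp]: "sat E (fSubset i j) s \<longleftrightarrow> elts E (s i) \<subseteq> elts E (s j)"
  by (auto simp: fSubset_def)

lemma sat_fUnion [simp]:
  "sat E (fUnion k i j) s \<longleftrightarrow> elts E (s k) = elts E (s i) \<union> elts E (s j)"
  by (auto simp: fUnion_def Let_def)

lemma sat_fDiff [simp]:
  "sat E (fDiff k i j) s \<longleftrightarrow> elts E (s k) = elts E (s i) - elts E (s j)"
  by (auto simp: fDiff_def Let_def)

lemma sat_fDisjoint [simp]:
  "sat E (fDisjoint i j) s \<longleftrightarrow> elts E (s i) \<inter> elts E (s j) = {}"
  by (auto simp: fDisjoint_def)

lemma sat_fDoubleton [simp]:
  "sat E (fDoubleton k i j) s \<longleftrightarrow> elts E (s k) = {s i, s j}"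
  by (auto simp: fDoubleton_def Let_def)

text \<open>
  Extensionality and pairing suffice to evaluate codes and Kuratowski pairs. Both the
  standard superstructure and the collection of internal objects satisfy them, so everything
  proved here applies to both sides of a transfer.
\<close>
locale membership_pairs =
  fixes E :: "'v \<Rightarrow> 'v \<Rightarrow> bool" and X :: "'v set"
  assumes ext: "a \<notin> X \<Longrightarrow> b \<notin> X \<Longrightarrow> elts E a = elts E b \<Longrightarrow> a = b"
    and pairing: "\<exists>c. c \<notin> X \<and> elts E c = {a, b}"
begin

lemma code_elts: "a \<notin> X \<Longrightarrow> code E X (elts E a) = a"
  unfolding code_def by (rule the_equality) (auto intro: ext)

lemma code_eqI: "a \<notin> X \<Longrightarrow> elts E a = A \<Longrightarrow> code E X A = a"
  using code_elts by auto

lemma code_doubleton: "code E X {a, b} \<notin> X" "elts E (code E X {a, b}) = {a, b}"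
proof -
  obtain c where "c \<notin> X" "elts E c = {a, b}" using pairing by blast
  with code_eqI[OF this] show "code E X {a, b} \<notin> X" "elts E (code E X {a, b}) = {a, b}"
    by auto
qed

lemma code_singleton: "code E X {a} \<notin> X" "elts E (code E X {a}) = {a}"
  using code_doubleton[of a a] by auto

lemma kpair_not_atom: "kpair E X a b \<notin> X"
  unfolding kpair_def by (rule code_doubleton)

lemma elts_kpair: "elts E (kpair E X a b) = {code E X {a}, code E X {a, b}}"
  unfolding kpair_def by (rule code_doubleton)

lemma kpair_eq_iff:
  "p = kpair E X a b \<longleftrightarrow> p \<notin> X \<and> (\<exists>c d. elts E p = {c, d} \<and> c \<notin> X \<and> d \<notin> X \<and>
    elts E c = {a} \<and> elts E d = {a, b})"
proof
  assume "p = kpair E X a b"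
  then show "p \<notin> X \<and> (\<exists>c d. elts E p = {c, d} \<and> c \<notin> X \<and> d \<notin> X \<and>
      elts E c = {a} \<and> elts E d = {a, b})"
    by (intro conjI exI[of _ "code E X {a}"] exI[of _ "code E X {a, b}"])
      (simp_all add: kpair_not_atom elts_kpair code_singleton code_doubleton)
next
  assume "p \<notin> X \<and> (\<exists>c d. elts E p = {c, d} \<and> c \<notin> X \<and> d \<notin> X \<and>
    elts E c = {a} \<and> elts E d = {a, b})"
  then obtain c d where *: "p \<notin> X" "elts E p = {c, d}" "c \<notin> X" "d \<notin> X"
    "elts E c = {a}" "elts E d = {a, b}" by blast
  have "c = code E X {a}" using code_eqI[OF *(3,5)] by simp
  moreover have "d = code E X {a, b}" using code_eqI[OF *(4,6)] by simp
  moreover have "p = code E X {c, d}" using code_eqI[OF *(1,2)] by simp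
  ultimately show "p = kpair E X a b" unfolding kpair_def by simp
qed

lemma kpair_inject [simp]: "kpair E X a b = kpair E X a' b' \<longleftrightarrow> a = a' \<and> b = b'"
proof
  assume "kpair E X a b = kpair E X a' b'"
  then have eq: "{code E X {a}, code E X {a, b}} = {code E X {a'}, code E X {a', b'}}"
    using elts_kpair[of a b] elts_kpair[of a' b'] by simp
  then have "elts E ` {code E X {a}, code E X {a, b}} = elts E ` {code E X {a'}, code E X {a', b'}}"
    by simp
  then have "{{a}, {a, b}} = {{a'}, {a', b'}}"
    by (simp add: code_singleton code_doubleton)
  then show "a = a' \<and> b = b'" by (auto simp: doubleton_eq_iff)
qed auto

lemma sat_fPair [simp]:
  "elts E (s x) = X \<Longrightarrow> sat E (fPair x p i j) s \<longleftrightarrow> s p = kpair E X (s i) (s j)"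
  unfolding kpair_eq_iff by (simp add: fPair_def Let_def) blast

lemma sat_fPairMem [simp]:
  "elts E (s x) = X \<Longrightarrow> sat E (fPairMem x n i j) s \<longleftrightarrow> kpair E X (s i) (s j) \<in> elts E (s n)"
  by (auto simp: fPairMem_def Let_def)

lemma sat_fTripleMem [simp]:
  assumes "elts E (s x) = X"
  shows "sat E (fTripleMem x n i j k) s \<longleftrightarrow>
    kpair E X (kpair E X (s i) (s j)) (s k) \<in> elts E (s n)"
proof -
  have "\<exists>c\<in>elts E (kpair E X q t). q \<in> elts E c" for q t
    by (simp add: elts_kpair code_singleton)
  then show ?thesis using assms by (auto simp: fTripleMem_def Let_def)
qed

definition fam :: "'v \<Rightarrow> 'v set set" where
  "fam h = elts E ` elts E h"

text \<open>
  Requiring \<open>w\<close> itself, and not just its extension, to belong to \<open>h\<close> makes \<open>w\<close> the code of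
  the whole space without a further condition that \<open>w\<close> is not an atom.
\<close>
definition alg_code :: "'v \<Rightarrow> 'v \<Rightarrow> bool" where
  "alg_code w h \<longleftrightarrow> w \<in> elts E h \<and> (\<forall>a\<in>elts E h. a \<notin> X) \<and> algebra (elts E w) (fam h)"

lemma in_fam_iff: "B \<in> fam h \<longleftrightarrow> (\<exists>c\<in>elts E h. elts E c = B)"
  by (auto simp: fam_def)

lemma alg_code_iff:
  "alg_code w h \<longleftrightarrow> w \<in> elts E h \<and>
    (\<forall>a\<in>elts E h. a \<notin> X \<and> elts E a \<subseteq> elts E w \<and> elts E w - elts E a \<in> fam h) \<and>
    (\<forall>a\<in>elts E h. \<forall>b\<in>elts E h. elts E a \<union> elts E b \<in> fam h)" (is "_ = (_ \<and> ?B \<and> ?C)")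
proof -
  have "{} \<in> fam h" if "w \<in> elts E h" ?B
  proof -
    have "elts E w - elts E w \<in> fam h" using that by blast
    then show ?thesis by simp
  qed
  moreover have "(\<forall>A\<in>fam h. P A) \<longleftrightarrow> (\<forall>a\<in>elts E h. P (elts E a))" for P
    by (auto simp: fam_def)
  moreover have "fam h \<subseteq> Pow W \<longleftrightarrow> (\<forall>a\<in>elts E h. elts E a \<subseteq> W)" for W
    by (auto simp: fam_def)
  ultimately show ?thesis
    unfolding alg_code_def algebra_iff_Un by (simp add: ball_conj_distrib) argo
qed

lemma sat_fAlgebra [simp]:
  assumes "elts E (s x) = X"
  shows "sat E (fAlgebra x w h) s \<longleftrightarrow> alg_code (s w) (s h)"
  unfolding alg_code_iff in_fam_iff using assms by (simp add: fAlgebra_def Let_def)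

end

section \<open>Codes in the superstructure and transfer\<close>

context superstructure
begin

lemma level_mono: "m \<le> n \<Longrightarrow> level E X m \<subseteq> level E X n"
  by (rule lift_Suc_mono_le[of "level E X"]) auto

lemma elts_level:
  "a \<in> level E X n \<Longrightarrow> elts E a \<subseteq> level E X n"
proof (induction n)
  case 0
  then show ?case using atoms_empty by simp
qed auto

lemma code_level:
  assumes "A \<subseteq> level E X n"
  shows "code E X A \<notin> X" "elts E (code E X A) = A" "code E X A \<in> level E X (Suc n)"
proof -
  obtain a where a: "a \<notin> X" "elts E a = A" using full[OF assms] by blast
  then have "code E X A = a"
    unfolding code_def by (intro the_equality) (auto intro: extensional)
  then show "code E X A \<notin> X" "elts E (code E X A) = A" "code E X A \<in> level E X (Suc n)"
    using a assms by auto
qed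

lemma ex_common_level: "\<exists>n. a \<in> level E X n \<and> b \<in> level E X n"
proof -
  obtain m n where "a \<in> level E X m" "b \<in> level E X n" using exhaust by blast
  then have "a \<in> level E X (max m n)" "b \<in> level E X (max m n)"
    using level_mono[of m "max m n"] level_mono[of n "max m n"] by auto
  then show ?thesis by blast
qed

sublocale membership_pairs E X
proof
  fix a b
  obtain n where "{a, b} \<subseteq> level E X n" using ex_common_level[of a b] by auto
  from code_level[OF this] show "\<exists>c. c \<notin> X \<and> elts E c = {a, b}" by blast
qed (rule extensional)

text \<open>
  Subsets of a coded set stay on its level instead of moving one level up. This is what keeps the
  algebra generated by two finite algebras in the same \<open>Pfin_code k\<close> as these.
\<close>
lemma code_subset_level:
  assumes "b \<in> level E X k" "b \<notin> X" "C \<subseteq> elts E b"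
  shows "code E X C \<notin> X" "elts E (code E X C) = C" "code E X C \<in> level E X k"
proof -
  have "C \<subseteq> level E X k" using elts_level assms by blast
  then show "code E X C \<notin> X" "elts E (code E X C) = C" by (rule code_level)+
  show "code E X C \<in> level E X k"
    using assms
  proof (induction k)
    case (Suc k)
    then show ?case
    proof (cases "b \<in> level E X k")
      case False
      then show ?thesis using Suc.prems by (intro code_level) auto
    qed auto
  qed simp
qed

lemma kpair_level:
  assumes "a \<in> level E X n" "b \<in> level E X n"
  shows "kpair E X a b \<in> level E X (Suc (Suc n))"
proof -
  have "code E X {a} \<in> level E X (Suc n)" "code E X {a, b} \<in> level E X (Suc n)"
    using assms by (auto simp del: level.simps intro: code_level(3))
  then show ?thesis unfolding kpair_def by (intro code_level(3)) simp
qed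

end

text \<open>
  An assignment that lists the values of the first variables. The junk value for all others is the
  head of the list, so that composition with a function acts on the list alone.
\<close>
definition env :: "'a list \<Rightarrow> nat \<Rightarrow> 'a" where
  "env xs i = (if i < length xs then xs ! i else hd xs)"

lemma env_simps [simp]:
  "env (x # xs) 0 = x"
  "env (x # y # xs) (Suc i) = (if i < length (y # xs) then (y # xs) ! i else x)"
  "env (x # y # xs) (numeral k) =
    (if pred_numeral k < length (y # xs) then (y # xs) ! pred_numeral k else x)"
  by (auto simp: env_def numeral_eq_Suc)

lemma comp_env: "xs \<noteq> [] \<Longrightarrow> f \<circ> env xs = env (map f xs)"
  by (auto simp: env_def fun_eq_iff hd_map)

context nonstandard_universe
begin

sublocale std: superstructure "mem U" "atoms U"
  by (rule standard)

lemma transfer_env: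
  "xs \<noteq> [] \<Longrightarrow> sat (mem U) \<phi> (env xs) \<longleftrightarrow> sat (imem U) \<phi> (env (map (star U) xs))"
  using transfer[of \<phi> "env xs"] by (simp add: comp_env)

text \<open>
  The standard sets whose extensions bound the quantifiers and serve as parameters in the
  transferred formulas.
\<close>
definition atoms_code where "atoms_code = scode U (atoms U)"
definition level_code where "level_code k = scode U (level (mem U) (atoms U) k)"
definition Pfin_code where
  "Pfin_code k = scode U {scode U A | A. finite A \<and> A \<subseteq> level (mem U) (atoms U) k}"
definition reals_code where "reals_code = scode U (range (re U))"
definition le_code where
  "le_code = scode U {spair U (re U r) (re U s) | r s. r \<le> s}"
definition add_code where
  "add_code = scode U {spair U (spair U (re U r) (re U s)) (re U (r + s)) | r s. True}"

lemma re_level: "re U r \<in> level (mem U) (atoms U) n"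
  using re_atom std.level_mono[of 0 n] by auto

lemma elts_atoms_code [simp]: "elts (mem U) atoms_code = atoms U"
  unfolding atoms_code_def
  by (rule std.code_level[of _ 0]) simp

lemma elts_level_code [simp]: "elts (mem U) (level_code k) = level (mem U) (atoms U) k"
  unfolding level_code_def
  by (rule std.code_level[of _ k]) simp

lemma elts_Pfin_code [simp]:
  "elts (mem U) (Pfin_code k) = {scode U A | A. finite A \<and> A \<subseteq> level (mem U) (atoms U) k}"
  unfolding Pfin_code_def
  by (rule std.code_level[of _ "Suc k"]) (auto simp del: level.simps intro: std.code_level(3))

lemma elts_reals_code [simp]: "elts (mem U) reals_code = range (re U)"
  unfolding reals_code_def
  by (rule std.code_level[of _ 0]) (use re_atom in simp)

lemma elts_le_code [simp]:
  "elts (mem U) le_code = {spair U (re U r) (re U s) | r s. r \<le> s}"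
  unfolding le_code_def
  by (rule std.code_level[of _ "Suc (Suc 0)"])
    (auto simp del: level.simps intro!: std.kpair_level re_level)

lemma elts_add_code [simp]:
  "elts (mem U) add_code = {spair U (spair U (re U r) (re U s)) (re U (r + s)) | r s. True}"
  unfolding add_code_def
  by (rule std.code_level[of _ "Suc (Suc (Suc (Suc 0)))"])
    (auto simp del: level.simps intro!: std.kpair_level re_level)

lemma re_eq_iff [simp]: "re U r = re U s \<longleftrightarrow> r = s"
  using re_inj by (auto dest: injD)

lemma le_code_iff [simp]:
  "spair U (re U r) (re U s) \<in> elts (mem U) le_code \<longleftrightarrow> r \<le> s"
  by auto

lemma add_code_iff [simp]:
  "spair U (spair U (re U r) (re U s)) z \<in> elts (mem U) add_code \<longleftrightarrow> z = re U (r + s)"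
  by auto

lemma elts_star_atoms_code [simp]: "elts (imem U) (star U atoms_code) = iatoms U"
  by (simp add: iatoms_def atoms_code_def)

lemma elts_star_reals_code [simp]: "elts (imem U) (star U reals_code) = hyperreals U"
  by (simp add: hyperreals_def reals_code_def)

lemma star_mono:
  assumes "elts (mem U) a \<subseteq> elts (mem U) b"
  shows "elts (imem U) (star U a) \<subseteq> elts (imem U) (star U b)"
  using transfer_env[of "[a, b]" "fSubset 0 1"] assms by simp

abbreviation ilevel where "ilevel k \<equiv> elts (imem U) (star U (level_code k))"

lemma ilevel_mono: "m \<le> n \<Longrightarrow> ilevel m \<subseteq> ilevel n"
  by (rule star_mono) (simp add: std.level_mono)

text \<open>
  Every internal object lies in the extension of a level, so quantifiers over internal
  objects can be bounded by a level before a transfer.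
\<close>
lemma ex_ilevel: "\<exists>n. w \<in> ilevel n"
proof -
  obtain v where v: "w \<in> elts (imem U) (star U v)"
    using all_internal[of w] by (auto simp: elts_def)
  obtain n where "v \<in> level (mem U) (atoms U) n" using std.exhaust by blast
  then have "elts (mem U) v \<subseteq> elts (mem U) (level_code n)" using std.elts_level by simp
  then show ?thesis using subsetD[OF star_mono v] by blast
qed

lemma ex_common_ilevel: "\<exists>n. a \<in> ilevel n \<and> b \<in> ilevel n"
proof -
  obtain m n where "a \<in> ilevel m" "b \<in> ilevel n" using ex_ilevel by blast
  then have "a \<in> ilevel (max m n)" "b \<in> ilevel (max m n)"
    using ilevel_mono[of m "max m n"] ilevel_mono[of n "max m n"] by auto
  then show ?thesis by blast
qed

text \<open>
  Pairing and extensionality are transferred level by level.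
\<close>
sublocale ns: membership_pairs "imem U" "iatoms U"
proof
  fix a b
  obtain n where n: "a \<in> ilevel n" "b \<in> ilevel n" using ex_common_ilevel by blast
  have "\<forall>a\<in>level (mem U) (atoms U) n. \<forall>b\<in>level (mem U) (atoms U) n.
      \<exists>c\<in>level (mem U) (atoms U) (Suc n). c \<notin> atoms U \<and> elts (mem U) c = {a, b}"
  proof (intro ballI)
    fix a b assume "a \<in> level (mem U) (atoms U) n" "b \<in> level (mem U) (atoms U) n"
    then have "{a, b} \<subseteq> level (mem U) (atoms U) n" by simp
    from std.code_level[OF this] show "\<exists>c\<in>level (mem U) (atoms U) (Suc n).
        c \<notin> atoms U \<and> elts (mem U) c = {a, b}" by blast
  qed
  then have "\<forall>a\<in>ilevel n. \<forall>b\<in>ilevel n.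
      \<exists>c\<in>ilevel (Suc n). c \<notin> iatoms U \<and> elts (imem U) c = {a, b}"
    using transfer_env[of "[atoms_code, level_code n, level_code (Suc n)]"
      "fAll 3 1 (fAll 4 1 (BEx 5 2 (Conj (Neg (Mem 5 0)) (fDoubleton 5 3 4))))"]
    by (simp del: level.simps)
  then show "\<exists>c. c \<notin> iatoms U \<and> elts (imem U) c = {a, b}" using n by blast
  have "\<forall>a\<in>level (mem U) (atoms U) n. \<forall>b\<in>level (mem U) (atoms U) n.
      a \<notin> atoms U \<and> b \<notin> atoms U \<and> elts (mem U) a \<subseteq> elts (mem U) b \<and>
      elts (mem U) b \<subseteq> elts (mem U) a \<longrightarrow> a = b"
    using std.extensional by (auto intro: equalityI)
  then have "\<forall>a\<in>ilevel n. \<forall>b\<in>ilevel n. a \<notin> iatoms U \<and> b \<notin> iatoms U \<and>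
      elts (imem U) a \<subseteq> elts (imem U) b \<and> elts (imem U) b \<subseteq> elts (imem U) a \<longrightarrow> a = b"
    using transfer_env[of "[atoms_code, level_code n]"
      "fAll 2 1 (fAll 3 1 (fImp (Conj (Neg (Mem 2 0)) (Conj (Neg (Mem 3 0))
        (Conj (fSubset 2 3) (fSubset 3 2)))) (Eq 2 3)))"]
    by simp
  then show "a \<notin> iatoms U \<Longrightarrow> b \<notin> iatoms U \<Longrightarrow> elts (imem U) a = elts (imem U) b \<Longrightarrow> a = b"
    using n by blast
qed

lemma internal_iff_code:
  "internal U S \<longleftrightarrow> icode U S \<notin> iatoms U \<and> elts (imem U) (icode U S) = S"
  using ns.code_elts by (auto simp: internal_def)

section \<open>Order and addition of the hyperreals\<close>

abbreviation real_env where
  "real_env \<equiv> [atoms_code, reals_code, le_code, add_code, re U 0]"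

lemma hle_iff: "hle U x y \<longleftrightarrow> ipair U x y \<in> elts (imem U) (star U le_code)"
  by (simp add: hle_def elts_def le_code_def)

lemma hreal_in [simp]: "hreal U r \<in> hyperreals U"
  using transfer_env[of "[reals_code, re U r]" "Mem 1 0"] by (simp add: hreal_def)

lemma hle_hreal [simp]: "hle U (hreal U r) (hreal U s) \<longleftrightarrow> r \<le> s"
proof -
  have "r \<le> s \<longleftrightarrow> spair U (re U r) (re U s) \<in> elts (mem U) le_code" by auto
  also have "\<dots> \<longleftrightarrow> hle U (hreal U r) (hreal U s)"
    using transfer_env[of "[atoms_code, le_code, re U r, re U s]" "fPairMem 0 1 2 3"]
    by (simp add: hle_iff hreal_def del: elts_le_code)
  finally show ?thesis by simp
qed

lemma transfer_envI:
  "sat (mem U) \<phi> (env xs) \<Longrightarrow> xs \<noteq> [] \<Longrightarrow> sat (imem U) \<phi> (env (map (star U) xs))"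
  by (simp add: transfer_env)

lemma hle_trans:
  assumes "x \<in> hyperreals U" "y \<in> hyperreals U" "z \<in> hyperreals U" "hle U x y" "hle U y z"
  shows "hle U x z"
proof -
  let ?\<phi> = "fAll 5 1 (fAll 6 1 (fAll 7 1
      (fImp (fPairMem 0 2 5 6) (fImp (fPairMem 0 2 6 7) (fPairMem 0 2 5 7)))))"
  have "sat (mem U) ?\<phi> (env real_env)"
    by (auto simp del: elts_le_code)
  from transfer_envI[OF this, simplified, rule_format, of x y z] show ?thesis
    using assms unfolding hle_iff by simp
qed

lemma hle_total:
  assumes "x \<in> hyperreals U" "y \<in> hyperreals U"
  shows "hle U x y \<or> hle U y x"
proof -
  let ?\<phi> = "fAll 5 1 (fAll 6 1 (fDisj (fPairMem 0 2 5 6) (fPairMem 0 2 6 5)))"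
  have "sat (mem U) ?\<phi> (env real_env)"
    by (simp add: linear del: elts_le_code)
  from transfer_envI[OF this, simplified, rule_format, of x y] show ?thesis
    using assms unfolding hle_iff by simp
qed

text \<open>
  Uniqueness must hold among all internal objects, not only among hyperreals, because \<open>hadd\<close>
  is a definite description without a bound.
\<close>
lemma hadd_unique:
  assumes "x \<in> hyperreals U" "y \<in> hyperreals U"
  shows "\<exists>!z. ipair U (ipair U x y) z \<in> elts (imem U) (star U add_code)"
proof -
  let ?\<phi> = "fAll 5 1 (fAll 6 1 (BEx 7 1 (fTripleMem 0 3 5 6 7)))"
  have "sat (mem U) ?\<phi> (env real_env)"
    by (simp del: elts_add_code)
  from transfer_envI[OF this]
  have "\<exists>z. ipair U (ipair U x y) z \<in> elts (imem U) (star U add_code)"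
    using assms by auto
  moreover have "z = z'" if "ipair U (ipair U x y) z \<in> elts (imem U) (star U add_code)"
     "ipair U (ipair U x y) z' \<in> elts (imem U) (star U add_code)" for z z'
  proof -
    obtain k where k: "z \<in> ilevel k" "z' \<in> ilevel k" using ex_common_ilevel by blast
    let ?\<psi> = "fAll 6 1 (fAll 7 1 (fAll 8 5 (fAll 9 5
       (fImp (fTripleMem 0 3 6 7 8) (fImp (fTripleMem 0 3 6 7 9) (Eq 8 9))))))"
    have "sat (mem U) ?\<psi> (env (real_env @ [level_code k]))"
      by (simp del: elts_add_code)
    from transfer_envI[OF this, simplified, rule_format, of x y z z'] show ?thesis
      using assms that k by simp
  qed
  ultimately show ?thesis by blast
qed

lemma hadd_iff:
  assumes "x \<in> hyperreals U" "y \<in> hyperreals U"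
  shows "z = hadd U x y \<longleftrightarrow> ipair U (ipair U x y) z \<in> elts (imem U) (star U add_code)"
proof -
  have "hadd U x y = (THE z. ipair U (ipair U x y) z \<in> elts (imem U) (star U add_code))"
    by (simp add: hadd_def elts_def add_code_def)
  then show ?thesis
    using the1_equality[OF hadd_unique[OF assms], of z] theI'[OF hadd_unique[OF assms]]
    by auto
qed

lemma hadd_hreal [simp]: "hadd U (hreal U r) (hreal U s) = hreal U (r + s)"
proof -
  have "sat (mem U) (fTripleMem 0 1 2 3 4) (env [atoms_code, add_code, re U r, re U s, re U (r + s)])"
    by (simp del: elts_add_code)
  from transfer_envI[OF this]
  have "hreal U (r + s) = hadd U (hreal U r) (hreal U s)"
    unfolding hadd_iff[OF hreal_in hreal_in] by (simp add: hreal_def)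
  then show ?thesis by simp
qed

lemma hadd_mono:
  assumes "x \<in> hyperreals U" "y \<in> hyperreals U" "x' \<in> hyperreals U" "y' \<in> hyperreals U"
    "hadd U x y \<in> hyperreals U" "hadd U x' y' \<in> hyperreals U" "hle U x x'" "hle U y y'"
  shows "hle U (hadd U x y) (hadd U x' y')"
proof -
  let ?\<phi> = "fAll 5 1 (fAll 6 1 (fAll 7 1 (fAll 8 1 (fAll 9 1 (fAll 10 1
      (fImp (fTripleMem 0 3 5 6 7) (fImp (fTripleMem 0 3 8 9 10) (fImp (fPairMem 0 2 5 8)
        (fImp (fPairMem 0 2 6 9) (fPairMem 0 2 7 10))))))))))"
  have "sat (mem U) ?\<phi> (env real_env)"
    by (simp add: add_mono del: elts_add_code elts_le_code)
  note * = transfer_envI[OF this]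
  have "ipair U (ipair U x y) (hadd U x y) \<in> elts (imem U) (star U add_code)"
    "ipair U (ipair U x' y') (hadd U x' y') \<in> elts (imem U) (star U add_code)"
    using hadd_iff assms by blast+
  with *[simplified, rule_format, of x y "hadd U x y" x' y' "hadd U x' y'"]
  show ?thesis using assms unfolding hle_iff by simp
qed

end

section \<open>Merging two finite algebras by transfer\<close>

text \<open>
  In the following predicates, codes stand for the objects of the combinatorial part:
  \<open>f\<close> and \<open>g\<close> for the two algebras on the set coded by \<open>w\<close>, \<open>n\<close> for the graph of the
  measure on the second, \<open>h\<close> for the generated algebra and \<open>m\<close> for the exceptional set. The
  parameters \<open>R\<close>, \<open>LE\<close>, \<open>AD\<close>, \<open>z\<close> are the set of reals, its order, its addition and zero,
  and \<open>K\<close> is the collection of finite subsets of a level.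
\<close>

context membership_pairs
begin

definition measure_code where
  "measure_code R LE AD z g n \<longleftrightarrow>
    (\<forall>a\<in>elts E g. \<exists>r\<in>elts E R. kpair E X a r \<in> elts E n) \<and>
    (\<forall>a\<in>elts E g. \<forall>r\<in>elts E R. \<forall>r'\<in>elts E R.
      kpair E X a r \<in> elts E n \<longrightarrow> kpair E X a r' \<in> elts E n \<longrightarrow> r = r') \<and>
    (\<forall>a\<in>elts E g. \<forall>r\<in>elts E R. kpair E X a r \<in> elts E n \<longrightarrow> kpair E X z r \<in> elts E LE) \<and>
    (\<forall>a\<in>elts E g. \<forall>b\<in>elts E g. \<forall>c\<in>elts E g.
      elts E a \<inter> elts E b = {} \<and> elts E c = elts E a \<union> elts E b \<longrightarrow>
      (\<forall>r\<in>elts E R. \<forall>s\<in>elts E R. \<forall>t\<in>elts E R. kpair E X a r \<in> elts E n \<longrightarrow>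
        kpair E X b s \<in> elts E n \<longrightarrow> kpair E X c t \<in> elts E n \<longrightarrow>
        kpair E X (kpair E X r s) t \<in> elts E AD))"

definition generated_code where
  "generated_code K f g w h \<longleftrightarrow> alg_code w h \<and> elts E f \<subseteq> elts E h \<and> elts E g \<subseteq> elts E h \<and>
    (\<forall>k\<in>elts E K. alg_code w k \<longrightarrow> elts E f \<subseteq> elts E k \<longrightarrow> elts E g \<subseteq> elts E k \<longrightarrow>
      elts E h \<subseteq> elts E k)"

definition approx_code where
  "approx_code R LE f g n e \<longleftrightarrow> (\<forall>a\<in>elts E f. \<exists>b\<in>elts E g. \<exists>b'\<in>elts E g. \<exists>d\<in>elts E g.
    elts E b \<subseteq> elts E a \<and> elts E a \<subseteq> elts E b' \<and> elts E d = elts E b' - elts E b \<and>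
    (\<exists>r\<in>elts E R. kpair E X d r \<in> elts E n \<and> kpair E X r e \<in> elts E LE))"

text \<open>
  The quantifier over \<open>e\<close> comes after \<open>m\<close>: a single set has to be small for all error bounds at
  once. This uniformity makes its measure infinitesimal after the transfer.
\<close>
definition exceptional_code where
  "exceptional_code R LE AD f g n h m \<longleftrightarrow>
    (\<forall>c\<in>elts E h. \<exists>d\<in>elts E g. elts E d = elts E c - elts E m) \<and>
    (\<forall>e\<in>elts E R. \<forall>e2\<in>elts E R. kpair E X (kpair E X e e) e2 \<in> elts E AD \<longrightarrow>
      approx_code R LE f g n e \<longrightarrow>
      (\<forall>r\<in>elts E R. kpair E X m r \<in> elts E n \<longrightarrow> kpair E X r e2 \<in> elts E LE))"

end

text \<open>
  The variables are fixed as follows: 0 to 4 are the atoms, the reals, their order, their addition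
  and zero; 5 is the collection of finite sets, 6 a level; 7 to 12 are
  \<open>f\<close>, \<open>g\<close>, \<open>w\<close>, \<open>n\<close>, \<open>h\<close>, \<open>m\<close>; the others are bound.
\<close>
definition measure_formula where
  "measure_formula =
    Conj (fAll 13 8 (BEx 14 1 (fPairMem 0 10 13 14)))
    (Conj (fAll 13 8 (fAll 14 1 (fAll 15 1
      (fImp (fPairMem 0 10 13 14) (fImp (fPairMem 0 10 13 15) (Eq 14 15))))))
    (Conj (fAll 13 8 (fAll 14 1 (fImp (fPairMem 0 10 13 14) (fPairMem 0 2 4 14))))
    (fAll 13 8 (fAll 14 8 (fAll 15 8 (fImp (Conj (fDisjoint 13 14) (fUnion 15 13 14))
      (fAll 16 1 (fAll 17 1 (fAll 18 1 (fImp (fPairMem 0 10 13 16) (fImp (fPairMem 0 10 14 17)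
        (fImp (fPairMem 0 10 15 18) (fTripleMem 0 3 16 17 18)))))))))))))"

definition generated_formula where
  "generated_formula =
    Conj (fAlgebra 0 9 11) (Conj (fSubset 7 11) (Conj (fSubset 8 11)
      (fAll 13 5 (fImp (fAlgebra 0 9 13) (fImp (fSubset 7 13) (fImp (fSubset 8 13)
        (fSubset 11 13)))))))"

definition approx_formula where
  "approx_formula = fAll 15 7 (BEx 16 8 (BEx 17 8 (BEx 18 8
    (Conj (fSubset 16 15) (Conj (fSubset 15 17) (Conj (fDiff 18 17 16)
      (BEx 19 1 (Conj (fPairMem 0 10 18 19) (fPairMem 0 2 19 13)))))))))"

definition exceptional_formula where
  "exceptional_formula =
    Conj (fAll 13 11 (BEx 14 8 (fDiff 14 13 12)))
      (fAll 13 1 (fAll 14 1 (fImp (fTripleMem 0 3 13 13 14) (fImp approx_formula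
        (fAll 15 1 (fImp (fPairMem 0 10 12 15) (fPairMem 0 2 15 14)))))))"

definition merge_formula where
  "merge_formula = fAll 7 5 (fAll 8 5 (fAll 9 7 (fAll 10 6
    (fImp (fAlgebra 0 9 7) (fImp (fAlgebra 0 9 8) (fImp measure_formula
      (BEx 11 5 (BEx 12 8 (Conj generated_formula exceptional_formula)))))))))"

context membership_pairs
begin

lemma sat_measure_formula [simp]:
  "elts E (s 0) = X \<Longrightarrow> sat E measure_formula s \<longleftrightarrow>
    measure_code (s 1) (s 2) (s 3) (s 4) (s 8) (s 10)"
  by (simp add: measure_formula_def measure_code_def)

lemma sat_generated_formula [simp]:
  "elts E (s 0) = X \<Longrightarrow> sat E generated_formula s \<longleftrightarrow>
    generated_code (s 5) (s 7) (s 8) (s 9) (s 11)"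
  by (simp add: generated_formula_def generated_code_def)

lemma sat_approx_formula [simp]:
  "elts E (s 0) = X \<Longrightarrow> sat E approx_formula s \<longleftrightarrow>
    approx_code (s 1) (s 2) (s 7) (s 8) (s 10) (s 13)"
  by (simp add: approx_formula_def approx_code_def)

lemma sat_exceptional_formula [simp]:
  "elts E (s 0) = X \<Longrightarrow> sat E exceptional_formula s \<longleftrightarrow>
    exceptional_code (s 1) (s 2) (s 3) (s 7) (s 8) (s 10) (s 11) (s 12)"
  by (simp add: exceptional_formula_def exceptional_code_def)

lemma sat_merge_formula:
  "elts E (s 0) = X \<Longrightarrow> sat E merge_formula s \<longleftrightarrow>
    (\<forall>f\<in>elts E (s 5). \<forall>g\<in>elts E (s 5). \<forall>w\<in>elts E f. \<forall>n\<in>elts E (s 6).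
      alg_code w f \<longrightarrow> alg_code w g \<longrightarrow> measure_code (s 1) (s 2) (s 3) (s 4) g n \<longrightarrow>
      (\<exists>h\<in>elts E (s 5). \<exists>m\<in>elts E g. generated_code (s 5) f g w h \<and>
        exceptional_code (s 1) (s 2) (s 3) f g n h m))"
  by (simp add: merge_formula_def)

lemma alg_code_unique: "alg_code w h \<Longrightarrow> c \<in> elts E h \<Longrightarrow> code E X (elts E c) = c"
  by (simp add: alg_code_def code_elts)

lemma alg_code_subset_iff:
  assumes "alg_code w h" "alg_code w k"
  shows "elts E h \<subseteq> elts E k \<longleftrightarrow> fam h \<subseteq> fam k"
proof
  assume *: "fam h \<subseteq> fam k"
  show "elts E h \<subseteq> elts E k"
  proof
    fix c assume c: "c \<in> elts E h"
    then have "elts E c \<in> fam k" using * by (auto simp: fam_def)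
    then obtain c' where c': "c' \<in> elts E k" "elts E c' = elts E c" by (auto simp: in_fam_iff)
    then have "c' = c" using ext[of c' c] c assms by (auto simp: alg_code_def)
    then show "c \<in> elts E k" using c' by simp
  qed
qed (auto simp: fam_def)

end

context nonstandard_universe
begin

lemma in_Pfin_iff:
  "a \<in> elts (mem U) (Pfin_code k) \<longleftrightarrow>
    a \<notin> atoms U \<and> finite (elts (mem U) a) \<and> elts (mem U) a \<subseteq> level (mem U) (atoms U) k"
proof
  assume "a \<in> elts (mem U) (Pfin_code k)"
  then show "a \<notin> atoms U \<and> finite (elts (mem U) a) \<and> elts (mem U) a \<subseteq> level (mem U) (atoms U) k"
    by (auto simp: elts_Pfin_code std.code_level)
next
  assume *: "a \<notin> atoms U \<and> finite (elts (mem U) a) \<and> elts (mem U) a \<subseteq> level (mem U) (atoms U) k"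
  then have "a = scode U (elts (mem U) a)" by (simp add: std.code_elts)
  then show "a \<in> elts (mem U) (Pfin_code k)" using * by (auto simp: elts_Pfin_code)
qed

declare elts_Pfin_code [simp del]

text \<open>
  The combinatorial part, translated into codes. Here \<open>h\<close> codes the algebra generated by the two
  given ones and \<open>m\<close> the union of the split atoms; the real-valued measure \<open>val\<close> is read off
  from its graph.
\<close>
lemma standard_merge:
  assumes f: "f \<in> elts (mem U) (Pfin_code k)" and g: "g \<in> elts (mem U) (Pfin_code k)"
    and wf: "w \<in> elts (mem U) f" and algf: "std.alg_code w f" and algg: "std.alg_code w g"
    and meas: "std.measure_code reals_code le_code add_code (re U 0) g n"
  shows "\<exists>h\<in>elts (mem U) (Pfin_code k). \<exists>m\<in>elts (mem U) g.
    std.generated_code (Pfin_code k) f g w h \<and>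
    std.exceptional_code reals_code le_code add_code f g n h m"
proof -
  define W where "W = elts (mem U) w"
  interpret two_finite_algebras W "std.fam f" "std.fam g"
    using algf algg f g unfolding std.alg_code_def in_Pfin_iff
    by (auto simp: two_finite_algebras_def two_finite_algebras_axioms_def W_def std.fam_def)
  obtain H where H: "algebra W H" "finite H" "std.fam f \<union> std.fam g \<subseteq> H"
    "\<And>K. algebra W K \<Longrightarrow> std.fam f \<union> std.fam g \<subseteq> K \<Longrightarrow> H \<subseteq> K"
    using finite_generated_algebra[of "std.fam f \<union> std.fam g" W]
      finite_F finite_G F.space_closed G.space_closed by auto
  interpret H: algebra W H by (rule H(1))
  have w: "w \<in> level (mem U) (atoms U) k" "w \<notin> atoms U"
    using wf f algf by (auto simp: in_Pfin_iff std.alg_code_def)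
  have codeH: "scode U C \<notin> atoms U" "elts (mem U) (scode U C) = C"
    "scode U C \<in> level (mem U) (atoms U) k" if "C \<in> H" for C
    using std.code_subset_level[OF w, of C] H.sets_into_space[OF that] by (auto simp: W_def)
  define h where "h = scode U (scode U ` H)"
  have sub: "scode U ` H \<subseteq> level (mem U) (atoms U) k" using codeH by auto
  have elts_h: "elts (mem U) h = scode U ` H" unfolding h_def by (rule std.code_level[OF sub])
  have h: "h \<in> elts (mem U) (Pfin_code k)"
    unfolding in_Pfin_iff elts_h using sub H(2) std.code_level(1)[OF sub] by (simp add: h_def)
  have fam_h: "std.fam h = H"
    using codeH by (auto simp: std.fam_def elts_h image_iff)
  have "w = scode U W" using w by (simp add: W_def std.code_elts)
  then have alg_h: "std.alg_code w h"
    using H(1) codeH H.top by (auto simp: std.alg_code_def fam_h elts_h W_def)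
  have gen: "std.generated_code (Pfin_code k) f g w h"
    unfolding std.generated_code_def
  proof (intro conjI ballI impI)
    show "elts (mem U) f \<subseteq> elts (mem U) h" "elts (mem U) g \<subseteq> elts (mem U) h"
      using H(3) by (auto simp: std.alg_code_subset_iff[OF _ alg_h] algf algg fam_h)
    fix k assume k: "std.alg_code w k" "elts (mem U) f \<subseteq> elts (mem U) k"
      "elts (mem U) g \<subseteq> elts (mem U) k"
    then have "H \<subseteq> std.fam k"
      by (intro H(4)) (auto simp: std.alg_code_def W_def std.fam_def)
    then show "elts (mem U) h \<subseteq> elts (mem U) k"
      by (simp add: std.alg_code_subset_iff[OF alg_h k(1)] fam_h)
  qed (rule alg_h)
  define val where "val A = (SOME r. spair U (scode U A) (re U r) \<in> elts (mem U) n)" for A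
  have val: "spair U a (re U r) \<in> elts (mem U) n \<longleftrightarrow> r = val (elts (mem U) a)"
    if "a \<in> elts (mem U) g" for a r
  proof -
    have "\<exists>r. spair U a (re U r) \<in> elts (mem U) n"
      using meas that by (auto simp: std.measure_code_def)
    moreover have "scode U (elts (mem U) a) = a" by (rule std.alg_code_unique[OF algg that])
    ultimately have "spair U a (re U (val (elts (mem U) a))) \<in> elts (mem U) n"
      unfolding val_def by (auto intro: someI_ex)
    moreover have "r = r'" if "spair U a (re U r) \<in> elts (mem U) n"
      "spair U a (re U r') \<in> elts (mem U) n" for r r'
      using meas that \<open>a \<in> elts (mem U) g\<close> unfolding std.measure_code_def
      by (metis elts_reals_code rangeI re_eq_iff)
    ultimately show ?thesis by blast
  qed
  have nonneg: "0 \<le> val A" if A: "A \<in> std.fam g" for A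
  proof -
    obtain a where a: "a \<in> elts (mem U) g" "A = elts (mem U) a" using A by (auto simp: std.fam_def)
    have "spair U a (re U (val A)) \<in> elts (mem U) n" using val a by simp
    then have "spair U (re U 0) (re U (val A)) \<in> elts (mem U) le_code"
      using meas a unfolding std.measure_code_def by (metis elts_reals_code rangeI)
    then show ?thesis by (simp del: elts_le_code)
  qed
  have add: "val (A \<union> B) = val A + val B"
    if AB: "A \<in> std.fam g" "B \<in> std.fam g" "A \<inter> B = {}" for A B
  proof -
    obtain a where a: "a \<in> elts (mem U) g" "A = elts (mem U) a" using AB by (auto simp: std.fam_def)
    obtain b where b: "b \<in> elts (mem U) g" "B = elts (mem U) b" using AB by (auto simp: std.fam_def)
    have "A \<union> B \<in> std.fam g" using AB by auto
    then obtain c where c: "c \<in> elts (mem U) g" "A \<union> B = elts (mem U) c"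
      by (auto simp: std.fam_def)
    have "\<forall>r\<in>range (re U). \<forall>s\<in>range (re U). \<forall>t\<in>range (re U).
       spair U a r \<in> elts (mem U) n \<longrightarrow> spair U b s \<in> elts (mem U) n \<longrightarrow>
       spair U c t \<in> elts (mem U) n \<longrightarrow> spair U (spair U r s) t \<in> elts (mem U) add_code"
      using meas a b c AB(3) unfolding std.measure_code_def elts_reals_code by blast
    then have "spair U (spair U (re U (val A)) (re U (val B))) (re U (val (A \<union> B)))
      \<in> elts (mem U) add_code"
      using val a b c by (simp del: elts_add_code add_code_iff)
    then show ?thesis by (simp del: elts_add_code)
  qed
  have "split_union \<in> std.fam g" by (rule split_union_in)
  then obtain m where m: "m \<in> elts (mem U) g" "split_union = elts (mem U) m"
    by (auto simp: std.fam_def)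
  have "std.exceptional_code reals_code le_code add_code f g n h m"
    unfolding std.exceptional_code_def
  proof (intro conjI ballI impI)
    fix c assume "c \<in> elts (mem U) h"
    then have "elts (mem U) c \<in> H" using fam_h by (auto simp: std.fam_def)
    then have "elts (mem U) c - split_union \<in> std.fam g"
      using H(4) by (intro generated_minus_split_union) auto
    then show "\<exists>d\<in>elts (mem U) g. elts (mem U) d = elts (mem U) c - elts (mem U) m"
      by (simp add: m std.in_fam_iff)
  next
    fix e e2 r
    assume "e \<in> elts (mem U) reals_code" "e2 \<in> elts (mem U) reals_code"
      and e2: "spair U (spair U e e) e2 \<in> elts (mem U) add_code"
      and approx: "std.approx_code reals_code le_code f g n e"
      and "r \<in> elts (mem U) reals_code" and r: "spair U m r \<in> elts (mem U) n"
    then obtain x y where x: "e = re U x" and y: "r = re U y" by auto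
    have e2: "e2 = re U (x + x)" using e2 by (simp add: x del: elts_add_code)
    have y: "r = re U (val split_union)" using r val m y by simp
    have "val split_union \<le> 2 * x"
    proof (rule measure_split_union_le[of val])
      fix A assume "A \<in> std.fam f"
      then obtain a where a: "a \<in> elts (mem U) f" "A = elts (mem U) a" by (auto simp: std.fam_def)
      then obtain b b' d r where b: "b \<in> elts (mem U) g" "b' \<in> elts (mem U) g" "d \<in> elts (mem U) g"
        "elts (mem U) b \<subseteq> A" "A \<subseteq> elts (mem U) b'"
        "elts (mem U) d = elts (mem U) b' - elts (mem U) b"
        "r \<in> range (re U)" "spair U d r \<in> elts (mem U) n" "spair U r e \<in> elts (mem U) le_code"
        using approx unfolding std.approx_code_def elts_reals_code by metis
      then have "val (elts (mem U) b' - elts (mem U) b) \<le> x"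
        using val[OF b(3)] by (auto simp: x simp del: elts_le_code)
      then show "\<exists>B\<in>std.fam g. \<exists>B'\<in>std.fam g. B \<subseteq> A \<and> A \<subseteq> B' \<and> val (B' - B) \<le> x"
        using b by (auto simp: std.fam_def)
    qed (use nonneg add in auto)
    then show "spair U r e2 \<in> elts (mem U) le_code" by (simp add: y e2 del: elts_le_code)
  qed
  then show ?thesis using h m gen by blast
qed

lemma internal_merge:
  assumes "f \<in> elts (imem U) (star U (Pfin_code k))" "g \<in> elts (imem U) (star U (Pfin_code k))"
    and "w \<in> elts (imem U) f" "ns.alg_code w f" "ns.alg_code w g"
    and "ns.measure_code (star U reals_code) (star U le_code) (star U add_code) (hreal U 0) g n"
  shows "\<exists>h\<in>elts (imem U) (star U (Pfin_code k)). \<exists>m\<in>elts (imem U) g.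
    ns.generated_code (star U (Pfin_code k)) f g w h \<and>
    ns.exceptional_code (star U reals_code) (star U le_code) (star U add_code) f g n h m"
proof -
  obtain j where j: "n \<in> ilevel j" using ex_ilevel by blast
  let ?env = "real_env @ [Pfin_code k, level_code j]"
  have "sat (mem U) merge_formula (env ?env)"
    by (subst std.sat_merge_formula, simp, simp del: elts_reals_code) (metis standard_merge)
  then have "sat (imem U) merge_formula (env (map (star U) ?env))"
    by (rule transfer_envI) simp
  then show ?thesis
    using assms j by (simp add: ns.sat_merge_formula hreal_def)
qed

end

section \<open>Standard parts\<close>

context nonstandard_universe
begin

lemma st_eqI:
  assumes x: "x \<in> hyperreals U"
    and r: "\<And>e. e > 0 \<Longrightarrow> hle U (hreal U (r - e)) x" "\<And>e. e > 0 \<Longrightarrow> hle U x (hreal U (r + e))"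
  shows "st U x = r"
  unfolding st_def
proof (rule the_equality)
  show "\<forall>e>0. hle U (hreal U (r - e)) x \<and> hle U x (hreal U (r + e))" using r by blast
  have le: "r1 \<le> r2" if "\<And>e. e > 0 \<Longrightarrow> hle U (hreal U (r1 - e)) x"
    "\<And>e. e > 0 \<Longrightarrow> hle U x (hreal U (r2 + e))" for r1 r2
  proof (rule ccontr)
    assume "\<not> r1 \<le> r2"
    define e where "e = (r1 - r2) / 3"
    have "e > 0" using \<open>\<not> r1 \<le> r2\<close> by (simp add: e_def)
    then have "hle U (hreal U (r1 - e)) (hreal U (r2 + e))"
      using that x by (intro hle_trans[of "hreal U (r1 - e)" x "hreal U (r2 + e)"]) auto
    then have "r1 - e \<le> r2 + e" by simp
    then show False using \<open>\<not> r1 \<le> r2\<close> by (simp add: e_def field_simps)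
  qed
  fix s assume s: "\<forall>e>0. hle U (hreal U (s - e)) x \<and> hle U x (hreal U (s + e))"
  show "s = r"
  proof (rule antisym)
    show "s \<le> r" by (rule le) (use s r in blast)+
    show "r \<le> s" by (rule le) (use s r in blast)+
  qed
qed

text \<open>
  The standard part of a finite hyperreal \<open>x\<close> exists because it is the supremum of the
  standard reals below \<open>x\<close>.
\<close>
lemma st_bounds:
  assumes x: "x \<in> hyperreals U" and a: "hle U (hreal U a) x" and b: "hle U x (hreal U b)"
    and e: "e > 0"
  shows "hle U (hreal U (st U x - e)) x" "hle U x (hreal U (st U x + e))"
proof -
  define S where "S = {r. hle U (hreal U r) x}"
  have aS: "a \<in> S" using a by (simp add: S_def)
  have bd: "r \<le> b" if "r \<in> S" for r
    using hle_trans[of "hreal U r" x "hreal U b"] x b that by (simp add: S_def)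
  have bdd: "bdd_above S" using bd by (rule bdd_aboveI)
  have 1: "hle U (hreal U (Sup S - e)) x" if pos: "e > 0" for e
  proof -
    obtain r where "r \<in> S" "Sup S - e < r"
      using less_cSupD[of S "Sup S - e"] aS pos by auto
    then show ?thesis
      using hle_trans[of "hreal U (Sup S - e)" "hreal U r" x] x by (simp add: S_def)
  qed
  have 2: "hle U x (hreal U (Sup S + e))" if "e > 0" for e
  proof (rule ccontr)
    assume "\<not> ?thesis"
    then have "Sup S + e \<in> S" using hle_total[OF x, of "hreal U (Sup S + e)"] by (simp add: S_def)
    then have "Sup S + e \<le> Sup S" using bdd by (rule cSup_upper)
    then show False using that by simp
  qed
  have "st U x = Sup S" by (rule st_eqI[OF x 1 2])
  then show "hle U (hreal U (st U x - e)) x" "hle U x (hreal U (st U x + e))"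
    using 1[OF e] 2[OF e] by simp_all
qed

lemma st_ge:
  assumes "x \<in> hyperreals U" "hle U (hreal U a) x" "hle U x (hreal U b)"
  shows "a \<le> st U x"
proof (rule field_le_epsilon)
  fix e :: real assume "e > 0"
  from st_bounds(2)[OF assms this] show "a \<le> st U x + e"
    using hle_trans[of "hreal U a" x "hreal U (st U x + e)"] assms by simp
qed

lemma st_le:
  assumes "x \<in> hyperreals U" "hle U (hreal U a) x" "hle U x (hreal U b)"
  shows "st U x \<le> b"
proof (rule field_le_epsilon)
  fix e :: real assume "e > 0"
  from st_bounds(1)[OF assms this] have "st U x - e \<le> b"
    using hle_trans[of "hreal U (st U x - e)" x "hreal U b"] assms by simp
  then show "st U x \<le> b + e" by simp
qed

lemma st_hreal [simp]: "st U (hreal U r) = r"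
  by (rule st_eqI) auto

lemma st_hadd:
  assumes x: "x \<in> hyperreals U" "hle U (hreal U a) x" "hle U x (hreal U b)"
    and y: "y \<in> hyperreals U" "hle U (hreal U c) y" "hle U y (hreal U d)"
    and z: "hadd U x y \<in> hyperreals U"
  shows "st U (hadd U x y) = st U x + st U y"
proof (rule st_eqI[OF z])
  fix e :: real assume "e > 0"
  then have e: "e / 2 > 0" by simp
  have "hle U (hadd U (hreal U (st U x - e / 2)) (hreal U (st U y - e / 2))) (hadd U x y)"
    using x(1) y(1) z st_bounds(1)[OF x e] st_bounds(1)[OF y e] by (intro hadd_mono) simp_all
  moreover have "st U x - e / 2 + (st U y - e / 2) = st U x + st U y - e" by simp
  ultimately show "hle U (hreal U (st U x + st U y - e)) (hadd U x y)"
    by simp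
  have "hle U (hadd U x y) (hadd U (hreal U (st U x + e / 2)) (hreal U (st U y + e / 2)))"
    using x(1) y(1) z st_bounds(2)[OF x e] st_bounds(2)[OF y e] by (intro hadd_mono) simp_all
  moreover have "st U x + e / 2 + (st U y + e / 2) = st U x + st U y + e" by simp
  ultimately show "hle U (hadd U x y) (hreal U (st U x + st U y + e))"
    by simp
qed

end

section \<open>Inner and outer Loeb measure\<close>

text \<open>
  The standard parts of the values of an internal probability measure form an ordinary finitely
  additive probability. Inner and outer measures depend on nothing else.
\<close>
locale internal_prob = nonstandard_universe U for U :: "('v, 'w) nonstandard_data" +
  fixes \<Omega> :: "'w set" and \<F> :: "'w set set" and \<mu> :: "'w set \<Rightarrow> 'w"
  assumes prob_space: "internal_prob_space U \<Omega> \<F> \<mu>"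
begin

sublocale algebra \<Omega> \<F>
  using prob_space by (simp add: internal_prob_space_def internal_algebra_def)

abbreviation st_mu where "st_mu A \<equiv> st U (\<mu> A)"

lemma mu_unit:
  "A \<in> \<F> \<Longrightarrow> \<mu> A \<in> hyperreals U"
  "A \<in> \<F> \<Longrightarrow> hle U (hreal U 0) (\<mu> A)"
  "A \<in> \<F> \<Longrightarrow> hle U (\<mu> A) (hreal U 1)"
  using prob_space by (auto simp: internal_prob_space_def internal_probability_def)

lemma mu_top: "\<mu> \<Omega> = hreal U 1"
  using prob_space by (auto simp: internal_prob_space_def internal_probability_def)

lemma mu_add:
  "A \<in> \<F> \<Longrightarrow> B \<in> \<F> \<Longrightarrow> A \<inter> B = {} \<Longrightarrow> \<mu> (A \<union> B) = hadd U (\<mu> A) (\<mu> B)"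
  using prob_space by (auto simp: internal_prob_space_def internal_probability_def)

lemma st_mu_nonneg: "A \<in> \<F> \<Longrightarrow> 0 \<le> st_mu A"
  by (rule st_ge[OF mu_unit])

lemma st_mu_le_1: "A \<in> \<F> \<Longrightarrow> st_mu A \<le> 1"
  by (rule st_le[OF mu_unit])

lemma st_mu_top: "st_mu \<Omega> = 1"
  by (simp add: mu_top)

lemma st_mu_add:
  assumes "A \<in> \<F>" "B \<in> \<F>" "A \<inter> B = {}" shows "st_mu (A \<union> B) = st_mu A + st_mu B"
proof -
  have "hadd U (\<mu> A) (\<mu> B) \<in> hyperreals U"
    using mu_unit(1)[of "A \<union> B"] mu_add[OF assms] assms by auto
  then show ?thesis
    unfolding mu_add[OF assms] using st_hadd[OF mu_unit[OF assms(1)] mu_unit[OF assms(2)]] by simp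
qed

lemma st_mu_diff:
  assumes "A \<in> \<F>" "B \<in> \<F>" "A \<subseteq> B" shows "st_mu (B - A) = st_mu B - st_mu A"
proof -
  have "B - A \<in> \<F>" "A \<inter> (B - A) = {}" "A \<union> (B - A) = B" using assms by auto
  then show ?thesis using st_mu_add[OF assms(1), of "B - A"] by simp
qed

lemma st_mu_mono: "A \<in> \<F> \<Longrightarrow> B \<in> \<F> \<Longrightarrow> A \<subseteq> B \<Longrightarrow> st_mu A \<le> st_mu B"
  using st_mu_diff[of A B] st_mu_nonneg[of "B - A"] by (simp add: Diff)

lemma st_mu_empty: "st_mu {} = 0"
  using st_mu_diff[of "{}" "{}"] by simp

lemma space_nonempty: "\<Omega> \<noteq> {}"
  using st_mu_top st_mu_empty by auto

lemma bdd_st_mu: "S \<subseteq> \<F> \<Longrightarrow> bdd_above (st_mu ` S)" "S \<subseteq> \<F> \<Longrightarrow> bdd_below (st_mu ` S)"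
  using st_mu_nonneg st_mu_le_1 by (auto intro!: bdd_aboveI2[where M = 1] bdd_belowI2[where m = 0])

lemma st_mu_le_inner: "A \<in> \<F> \<Longrightarrow> A \<subseteq> B \<Longrightarrow> st_mu A \<le> loeb_inner U \<F> \<mu> B"
  unfolding loeb_inner_def by (rule cSUP_upper) (auto intro: bdd_st_mu)

lemma outer_le_st_mu: "A \<in> \<F> \<Longrightarrow> B \<subseteq> A \<Longrightarrow> loeb_outer U \<F> \<mu> B \<le> st_mu A"
  unfolding loeb_outer_def by (rule cINF_lower) (auto intro: bdd_st_mu)

lemma inner_le: "(\<And>A. A \<in> \<F> \<Longrightarrow> A \<subseteq> B \<Longrightarrow> st_mu A \<le> c) \<Longrightarrow> loeb_inner U \<F> \<mu> B \<le> c"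
  unfolding loeb_inner_def by (rule cSUP_least) auto

lemma le_outer:
  "B \<subseteq> \<Omega> \<Longrightarrow> (\<And>A. A \<in> \<F> \<Longrightarrow> B \<subseteq> A \<Longrightarrow> c \<le> st_mu A) \<Longrightarrow> c \<le> loeb_outer U \<F> \<mu> B"
  unfolding loeb_outer_def by (rule cINF_greatest) (use top in auto)

lemma sets_subset_loeb_sets:
  assumes "A \<in> \<F>" shows "A \<in> loeb_sets U \<Omega> \<F> \<mu>"
proof -
  have A: "A \<subseteq> \<Omega>" using assms sets_into_space by auto
  have "loeb_inner U \<F> \<mu> A = st_mu A"
    using assms by (intro antisym inner_le st_mu_le_inner) (auto intro: st_mu_mono)
  moreover have "loeb_outer U \<F> \<mu> A = st_mu A"
    using assms A by (intro antisym le_outer outer_le_st_mu) (auto intro: st_mu_mono)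
  ultimately show ?thesis using A by (simp add: loeb_sets_def)
qed

lemma loeb_sets_approx:
  assumes B: "B \<in> loeb_sets U \<Omega> \<F> \<mu>" and e: "e > 0"
  shows "\<exists>C\<in>\<F>. \<exists>C'\<in>\<F>. C \<subseteq> B \<and> B \<subseteq> C' \<and> st_mu (C' - C) < e"
proof -
  have eq: "loeb_inner U \<F> \<mu> B = loeb_outer U \<F> \<mu> B" and sub: "B \<subseteq> \<Omega>"
    using B by (auto simp: loeb_sets_def)
  have "\<exists>C\<in>\<F>. C \<subseteq> B \<and> loeb_inner U \<F> \<mu> B - e / 2 < st_mu C"
  proof (rule ccontr)
    assume "\<not> ?thesis"
    then have "loeb_inner U \<F> \<mu> B \<le> loeb_inner U \<F> \<mu> B - e / 2"
      by (intro inner_le) (auto simp: not_less)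
    then show False using e by simp
  qed
  then obtain C where C: "C \<in> \<F>" "C \<subseteq> B" "loeb_inner U \<F> \<mu> B - e / 2 < st_mu C" by blast
  have "\<exists>C'\<in>\<F>. B \<subseteq> C' \<and> st_mu C' < loeb_outer U \<F> \<mu> B + e / 2"
  proof (rule ccontr)
    assume "\<not> ?thesis"
    then have "loeb_outer U \<F> \<mu> B + e / 2 \<le> loeb_outer U \<F> \<mu> B"
      using sub by (intro le_outer) (auto simp: not_less)
    then show False using e by simp
  qed
  then obtain C' where C': "C' \<in> \<F>" "B \<subseteq> C'" "st_mu C' < loeb_outer U \<F> \<mu> B + e / 2" by blast
  have "st_mu (C' - C) = st_mu C' - st_mu C" using C C' by (intro st_mu_diff) auto
  then have "st_mu (C' - C) < e" using C(3) C'(3) eq by (simp add: field_simps)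
  then show ?thesis using C C' by blast
qed

end

text \<open>
  An approximation of \<open>B\<close> from inside by \<open>C \<in> \<H>\<close> can be replaced by \<open>C - N\<close>, one from outside
  by \<open>C \<union> N\<close>. Both belong to \<open>\<G>\<close> and have the same standard measure as \<open>C\<close>.
\<close>
lemma loeb_equal_modulo_null:
  assumes G: "internal_prob U \<Omega> \<G> \<nu>" and H: "internal_prob U \<Omega> \<H> P" and sub: "\<G> \<subseteq> \<H>"
    and N: "N \<in> \<G>" "st U (\<nu> N) = 0"
    and HN: "\<And>C. C \<in> \<H> \<Longrightarrow> C - N \<in> \<G>"
    and P: "\<And>C. C \<in> \<H> \<Longrightarrow> st U (P C) = st U (\<nu> (C - N))"
    and B: "B \<subseteq> \<Omega>"
  shows "loeb_inner U \<H> P B = loeb_inner U \<G> \<nu> B" "loeb_outer U \<H> P B = loeb_outer U \<G> \<nu> B"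
proof -
  interpret G: internal_prob U \<Omega> \<G> \<nu> by (rule G)
  interpret H: internal_prob U \<Omega> \<H> P by (rule H)
  have CN: "G.st_mu (C \<union> N) = H.st_mu C" "C \<union> N \<in> \<G>" if "C \<in> \<H>" for C
  proof -
    have "C \<union> N = (C - N) \<union> N" by auto
    then show "G.st_mu (C \<union> N) = H.st_mu C" "C \<union> N \<in> \<G>"
      using G.st_mu_add[of "C - N" N] G.Un[of "C - N" N] HN[OF that] P[OF that] N by auto
  qed
  have PG: "H.st_mu C = G.st_mu C" if "C \<in> \<G>" for C
  proof (rule antisym)
    have C: "C \<in> \<H>" using sub that by auto
    show "H.st_mu C \<le> G.st_mu C" using P[OF C] HN[OF C] that by (auto intro: G.st_mu_mono)
    show "G.st_mu C \<le> H.st_mu C" using CN[OF C] that by (metis G.st_mu_mono sup_ge1)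
  qed
  show "loeb_inner U \<H> P B = loeb_inner U \<G> \<nu> B"
  proof (intro antisym H.inner_le G.inner_le)
    fix A assume "A \<in> \<H>" "A \<subseteq> B"
    then show "H.st_mu A \<le> loeb_inner U \<G> \<nu> B"
      using P HN by (auto intro!: G.st_mu_le_inner)
  next
    fix A assume A: "A \<in> \<G>" "A \<subseteq> B"
    then show "G.st_mu A \<le> loeb_inner U \<H> P B"
      using H.st_mu_le_inner[of A B] PG[OF A(1)] sub by auto
  qed
  show "loeb_outer U \<H> P B = loeb_outer U \<G> \<nu> B"
  proof (intro antisym H.le_outer G.le_outer B)
    fix A assume "A \<in> \<H>" "B \<subseteq> A"
    then show "loeb_outer U \<G> \<nu> B \<le> H.st_mu A"
      using CN[of A] G.outer_le_st_mu[of "A \<union> N" B] by auto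
  next
    fix A assume A: "A \<in> \<G>" "B \<subseteq> A"
    then show "loeb_outer U \<H> P B \<le> G.st_mu A"
      using H.outer_le_st_mu[of A B] PG[OF A(1)] sub by auto
  qed
qed

section \<open>Internal algebras and their codes\<close>

context nonstandard_universe
begin

lemma Pfin_mono:
  assumes "k \<le> l"
  shows "elts (imem U) (star U (Pfin_code k)) \<subseteq> elts (imem U) (star U (Pfin_code l))"
proof (intro star_mono subsetI)
  fix a assume "a \<in> elts (mem U) (Pfin_code k)"
  then show "a \<in> elts (mem U) (Pfin_code l)"
    using subset_trans[OF _ std.level_mono[OF assms]] by (simp add: in_Pfin_iff)
qed

lemma Pfin_not_atom:
  assumes "a \<in> elts (imem U) (star U (Pfin_code k))" shows "a \<notin> iatoms U"
proof -
  have "sat (mem U) (fAll 2 1 (Neg (Mem 2 0))) (env [atoms_code, Pfin_code k])"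
    by (simp add: in_Pfin_iff)
  from transfer_envI[OF this] show ?thesis using assms by auto
qed

text \<open>
  Subsets of finite sets are finite. The level that contains \<open>a\<close> only serves to state this
  with bounded quantifiers.
\<close>
lemma Pfin_inter:
  assumes "h \<in> elts (imem U) (star U (Pfin_code k))"
  shows "\<exists>i\<in>elts (imem U) (star U (Pfin_code k)).
    elts (imem U) i = elts (imem U) h \<inter> elts (imem U) a"
proof -
  obtain j where j: "a \<in> ilevel j" using ex_ilevel by blast
  let ?\<phi> = "fAll 2 0 (fAll 3 1 (BEx 4 0 (Conj (fAll 5 4 (Conj (Mem 5 2) (Mem 5 3)))
    (fAll 5 2 (fImp (Mem 5 3) (Mem 5 4))))))"
  have "\<exists>i\<in>elts (mem U) (Pfin_code k). elts (mem U) i = elts (mem U) h \<inter> elts (mem U) a"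
    if h: "h \<in> elts (mem U) (Pfin_code k)" for h a
  proof -
    have sub: "elts (mem U) h \<inter> elts (mem U) a \<subseteq> level (mem U) (atoms U) k"
      using h by (auto simp: in_Pfin_iff)
    show ?thesis
      using std.code_level[OF sub] h sub
      by (intro bexI[of _ "scode U (elts (mem U) h \<inter> elts (mem U) a)"]) (simp_all add: in_Pfin_iff)
  qed
  then have "sat (mem U) ?\<phi> (env [Pfin_code k, level_code j])"
    by (simp add: set_eq_iff) metis
  then have "sat (imem U) ?\<phi> (env (map (star U) [Pfin_code k, level_code j]))"
    by (rule transfer_envI) simp
  then have "\<exists>i\<in>elts (imem U) (star U (Pfin_code k)).
     (\<forall>x\<in>elts (imem U) i. x \<in> elts (imem U) h \<and> x \<in> elts (imem U) a) \<and>
     (\<forall>x\<in>elts (imem U) h. x \<in> elts (imem U) a \<longrightarrow> x \<in> elts (imem U) i)"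
    using assms j by simp
  then show ?thesis by blast
qed

text \<open>
  An instance of the internal definition principle: with \<open>n\<close> the graph of \<open>\<nu>\<close>, the set is the
  graph of \<open>c \<mapsto> \<nu> (T c)\<close>, where \<open>T\<close> adds \<open>m\<close> to the sets that contain \<open>x\<close> and removes
  it from the others.
\<close>
lemma internal_graph:
  assumes h: "h \<in> elts (imem U) (star U (Pfin_code k))"
    and g: "g \<in> elts (imem U) (star U (Pfin_code k))"
  shows "\<exists>q. q \<notin> iatoms U \<and> elts (imem U) q = {ipair U c r | c d r.
    c \<in> elts (imem U) h \<and> d \<in> elts (imem U) g \<and> r \<in> hyperreals U \<and>
    ipair U d r \<in> elts (imem U) n \<and>
    (x \<in> elts (imem U) c \<and> elts (imem U) d = elts (imem U) c \<union> elts (imem U) m \<or>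
     x \<notin> elts (imem U) c \<and> elts (imem U) d = elts (imem U) c - elts (imem U) m)}"
proof -
  obtain j1 where j1: "n \<in> ilevel j1" "m \<in> ilevel j1" using ex_common_ilevel by blast
  obtain j2 where j2: "x \<in> ilevel j2" using ex_ilevel by blast
  define j where "j = max j1 j2"
  have j: "n \<in> ilevel j" "m \<in> ilevel j" "x \<in> ilevel j"
    using j1 j2 ilevel_mono[of j1 j] ilevel_mono[of j2 j] by (auto simp: j_def)
  let ?rel = "Conj (fPairMem 0 7 13 14)
    (fDisj (Conj (Mem 9 12) (fUnion 13 12 8)) (Conj (Neg (Mem 9 12)) (fDiff 13 12 8)))"
  let ?\<phi> = "fAll 5 2 (fAll 6 2 (fAll 7 3 (fAll 8 3 (fAll 9 3 (BEx 10 4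
    (Conj (Neg (Mem 10 0)) (Conj
      (fAll 11 10 (BEx 12 5 (BEx 13 6 (BEx 14 1 (Conj (fPair 0 11 12 14) ?rel)))))
      (fAll 12 5 (fAll 13 6 (fAll 14 1 (fImp ?rel (fPairMem 0 10 12 14))))))))))))"
  let ?env = "[atoms_code, reals_code, Pfin_code k, level_code j, level_code (Suc (Suc (Suc k)))]"
  \<comment> \<open>The defining relation is kept abstract as \<open>Q\<close>: only the shape of the graph matters for
     finding a level that contains it.\<close>
  have graph: "\<exists>q\<in>level (mem U) (atoms U) (Suc (Suc (Suc k))). q \<notin> atoms U \<and>
     (\<forall>p\<in>elts (mem U) q. \<exists>c\<in>elts (mem U) h. \<exists>d\<in>elts (mem U) g. \<exists>r\<in>elts (mem U) reals_code.
        p = spair U c r \<and> Q c d r) \<and>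
     (\<forall>c\<in>elts (mem U) h. \<forall>d\<in>elts (mem U) g. \<forall>r\<in>elts (mem U) reals_code. Q c d r \<longrightarrow>
        spair U c r \<in> elts (mem U) q)" if h: "h \<in> elts (mem U) (Pfin_code k)" for h g Q
  proof -
    let ?S = "{p. \<exists>c\<in>elts (mem U) h. \<exists>d\<in>elts (mem U) g. \<exists>r\<in>elts (mem U) reals_code.
        p = spair U c r \<and> Q c d r}"
    have sub: "?S \<subseteq> level (mem U) (atoms U) (Suc (Suc k))"
      using h re_level by (auto simp: in_Pfin_iff simp del: level.simps intro!: std.kpair_level)
    define q where "q = scode U ?S"
    have q: "q \<notin> atoms U" "elts (mem U) q = ?S" "q \<in> level (mem U) (atoms U) (Suc (Suc (Suc k)))"
      using std.code_level[OF sub] by (simp_all add: q_def del: level.simps)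
    show ?thesis
      by (rule bexI[OF _ q(3)]) (use q(1) in \<open>auto simp: q(2)\<close>)
  qed
  have "sat (mem U) ?\<phi> (env ?env)"
    by (simp del: elts_reals_code level.simps) (intro ballI graph)
  then have "sat (imem U) ?\<phi> (env (map (star U) ?env))"
    by (rule transfer_envI) simp
  then obtain q where q: "q \<notin> iatoms U"
    "\<forall>p\<in>elts (imem U) q. \<exists>c\<in>elts (imem U) h. \<exists>d\<in>elts (imem U) g. \<exists>r\<in>hyperreals U.
      p = ipair U c r \<and> ipair U d r \<in> elts (imem U) n \<and>
      (x \<in> elts (imem U) c \<and> elts (imem U) d = elts (imem U) c \<union> elts (imem U) m \<or>
       x \<notin> elts (imem U) c \<and> elts (imem U) d = elts (imem U) c - elts (imem U) m)"
    "\<forall>c\<in>elts (imem U) h. \<forall>d\<in>elts (imem U) g. \<forall>r\<in>hyperreals U.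
      ipair U d r \<in> elts (imem U) n \<and>
      (x \<in> elts (imem U) c \<and> elts (imem U) d = elts (imem U) c \<union> elts (imem U) m \<or>
       x \<notin> elts (imem U) c \<and> elts (imem U) d = elts (imem U) c - elts (imem U) m) \<longrightarrow>
      ipair U c r \<in> elts (imem U) q"
    using h g j by (simp del: level.simps) blast
  then show ?thesis by (intro exI[of _ q]) blast
qed

lemma internal_algebra_code:
  assumes "internal_algebra U \<Omega> \<F>" "icode U ` \<F> = elts (imem U) f"
  shows "ns.alg_code (icode U \<Omega>) f" "ns.fam f = \<F>" "elts (imem U) (icode U \<Omega>) = \<Omega>"
    "\<And>A. A \<in> \<F> \<Longrightarrow> elts (imem U) (icode U A) = A"
proof -
  have F: "\<And>A. A \<in> \<F> \<Longrightarrow> icode U A \<notin> iatoms U \<and> elts (imem U) (icode U A) = A" "algebra \<Omega> \<F>"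
    using assms(1) by (auto simp: internal_algebra_def internal_iff_code)
  interpret algebra \<Omega> \<F> by (rule F(2))
  show "\<And>A. A \<in> \<F> \<Longrightarrow> elts (imem U) (icode U A) = A" using F by blast
  show *: "elts (imem U) (icode U \<Omega>) = \<Omega>" using F(1)[OF top] by blast
  show **: "ns.fam f = \<F>"
    using F(1) by (auto simp: ns.fam_def assms(2)[symmetric] image_iff)
  show "ns.alg_code (icode U \<Omega>) f"
    using F by (auto simp: ns.alg_code_def * ** assms(2)[symmetric])
qed

lemma alg_code_internal:
  assumes "ns.alg_code w h" "h \<notin> iatoms U"
  shows "internal_algebra U (elts (imem U) w) (ns.fam h)" "icode U ` ns.fam h = elts (imem U) h"
proof -
  have h: "w \<in> elts (imem U) h" "\<And>a. a \<in> elts (imem U) h \<Longrightarrow> a \<notin> iatoms U"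
    "algebra (elts (imem U) w) (ns.fam h)" using assms by (auto simp: ns.alg_code_def)
  show *: "icode U ` ns.fam h = elts (imem U) h"
    using h(2) ns.code_elts by (auto simp: ns.fam_def image_image)
  show "internal_algebra U (elts (imem U) w) (ns.fam h)"
    unfolding internal_algebra_def * internal_def ns.fam_def[of h, symmetric]
    using h assms(2) by (auto simp: ns.fam_def)
qed

text \<open>
  Transfer only makes \<open>h\<close> minimal among the hyperfinite algebras of a fixed level. An arbitrary internal
  algebra \<open>K\<close> is handled by its intersection with \<open>h\<close>, which is hyperfinite again.
\<close>
lemma generated_code_eq:
  assumes h: "h \<in> elts (imem U) (star U (Pfin_code k))"
    and gen: "ns.generated_code (star U (Pfin_code k)) f g w h"
  shows "generated_internal_algebra U (elts (imem U) w) (ns.fam f \<union> ns.fam g) = ns.fam h"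
proof -
  have h': "h \<notin> iatoms U" "ns.alg_code w h" "elts (imem U) f \<subseteq> elts (imem U) h"
    "elts (imem U) g \<subseteq> elts (imem U) h"
    using Pfin_not_atom[OF h] gen by (auto simp: ns.generated_code_def)
  have "ns.fam h \<subseteq> K"
    if K: "internal_algebra U (elts (imem U) w) K" "ns.fam f \<union> ns.fam g \<subseteq> K" for K
  proof -
    define k' where "k' = icode U (icode U ` K)"
    have k': "icode U ` K = elts (imem U) k'"
      using K(1) by (simp add: internal_algebra_def internal_iff_code k'_def)
    note Kc = internal_algebra_code[OF K(1) k']
    have w: "icode U (elts (imem U) w) = w"
      by (rule ns.alg_code_unique[OF h'(2)]) (use h'(2) in \<open>simp add: ns.alg_code_def\<close>)
    have algK: "ns.alg_code w k'" using Kc(1) by (simp add: w)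
    obtain i where i: "i \<in> elts (imem U) (star U (Pfin_code k))"
      "elts (imem U) i = elts (imem U) h \<inter> elts (imem U) k'"
      using Pfin_inter[OF h] by blast
    have fam_i: "ns.fam i = ns.fam h \<inter> ns.fam k'"
    proof
      show "ns.fam h \<inter> ns.fam k' \<subseteq> ns.fam i"
      proof
        fix A assume "A \<in> ns.fam h \<inter> ns.fam k'"
        then obtain a b where ab: "a \<in> elts (imem U) h" "b \<in> elts (imem U) k'"
          "elts (imem U) a = A" "elts (imem U) b = A" by (auto simp: ns.in_fam_iff)
        then have "a = b"
          using ns.ext[of a b] h'(2) algK by (auto simp: ns.alg_code_def)
        then show "A \<in> ns.fam i" using ab i(2) by (auto simp: ns.in_fam_iff)
      qed
    qed (auto simp: ns.fam_def i(2))
    have "ns.alg_code w i"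
      using h'(2) algK unfolding ns.alg_code_def fam_i algebra_iff_Un i(2) by auto
    moreover have "ns.fam f \<subseteq> ns.fam k'" "ns.fam g \<subseteq> ns.fam k'" using K(2) Kc(2) by auto
    have sub: "elts (imem U) e \<subseteq> elts (imem U) k'"
      if "elts (imem U) e \<subseteq> elts (imem U) h" "ns.fam e \<subseteq> K" for e
    proof
      fix a assume a: "a \<in> elts (imem U) e"
      then have "icode U (elts (imem U) a) = a" using that ns.alg_code_unique[OF h'(2)] by auto
      moreover have "elts (imem U) a \<in> K" using a that by (auto simp: ns.fam_def)
      ultimately show "a \<in> elts (imem U) k'" using k' by (metis imageI)
    qed
    have "elts (imem U) f \<subseteq> elts (imem U) i" "elts (imem U) g \<subseteq> elts (imem U) i"
      using sub[of f] sub[of g] h' K(2) i(2) by auto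
    ultimately have "elts (imem U) h \<subseteq> elts (imem U) i"
      using gen i(1) by (auto simp: ns.generated_code_def)
    then have "ns.fam h \<subseteq> ns.fam k'" using i(2) by (auto simp: ns.fam_def)
    then show "ns.fam h \<subseteq> K" using Kc(2) by simp
  qed
  moreover have "internal_algebra U (elts (imem U) w) (ns.fam h)"
    by (rule alg_code_internal) fact+
  moreover have "ns.fam f \<union> ns.fam g \<subseteq> ns.fam h" using h' by (auto simp: ns.fam_def)
  ultimately show ?thesis unfolding generated_internal_algebra_def by (intro equalityI) auto
qed

end

context internal_prob
begin

text \<open>
  The link between the measure as a function on internal sets and its graph as an internal object.
\<close>
lemma measure_code_graph:
  assumes f: "icode U ` \<F> = elts (imem U) f"
    and n: "elts (imem U) n = {ipair U (icode U A) (\<mu> A) | A. A \<in> \<F>}"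
  shows "ns.measure_code (star U reals_code) (star U le_code) (star U add_code) (hreal U 0) f n"
    and "a \<in> elts (imem U) f \<Longrightarrow> ipair U a r \<in> elts (imem U) n \<longleftrightarrow> r = \<mu> (elts (imem U) a)"
proof -
  have alg: "internal_algebra U \<Omega> \<F>" using prob_space by (simp add: internal_prob_space_def)
  note c = internal_algebra_code[OF alg f]
  show graph: "ipair U a r \<in> elts (imem U) n \<longleftrightarrow> r = \<mu> (elts (imem U) a)"
    if a: "a \<in> elts (imem U) f" for a r
  proof -
    obtain A where A: "A \<in> \<F>" "a = icode U A" using a f by auto
    have "B = A" if "B \<in> \<F>" "icode U A = icode U B" for B
      using c(4)[OF that(1)] c(4)[OF A(1)] that(2) by simp
    then show ?thesis using A c(4)[OF A(1)] by (auto simp: n)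
  qed
  have F: "elts (imem U) a \<in> \<F>" if "a \<in> elts (imem U) f" for a
    using that c(2) by (auto simp: ns.fam_def)
  show "ns.measure_code (star U reals_code) (star U le_code) (star U add_code) (hreal U 0) f n"
    unfolding ns.measure_code_def elts_star_reals_code
    using F mu_unit mu_add by (simp add: graph hle_iff[symmetric] hadd_iff[symmetric])
qed

end

section \<open>The measure on the generated algebra\<close>

theorem theorem1p6:
  fixes U :: "('v, 'w) nonstandard_data"
    and \<Omega> :: "'w set" and \<F> \<G> \<H> :: "'w set set" and \<mu> \<nu> :: "'w set \<Rightarrow> 'w"
  assumes "aleph1_saturated_universe U"
    and "hyperfinite_prob_space U \<Omega> \<F> \<mu>"
    and "hyperfinite_prob_space U \<Omega> \<G> \<nu>"
    and "loeb_equivalent U \<Omega> \<F> \<mu> \<G> \<nu>"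
    and "\<H> = generated_internal_algebra U \<Omega> (\<F> \<union> \<G>)"
  shows "\<exists>P. hyperfinite_prob_space U \<Omega> \<H> P \<and> loeb_equivalent U \<Omega> \<F> \<mu> \<H> P"
proof -
  interpret nonstandard_universe U
    using assms(1) by (simp add: aleph1_saturated_universe_def)
  have spaces: "internal_prob_space U \<Omega> \<F> \<mu>" "internal_prob_space U \<Omega> \<G> \<nu>"
    using assms(2,3) by (simp_all add: hyperfinite_prob_space_def)
  interpret F: internal_prob U \<Omega> \<F> \<mu> by unfold_locales (rule spaces)
  interpret G: internal_prob U \<Omega> \<G> \<nu> by unfold_locales (rule spaces)
  have algs: "internal_algebra U \<Omega> \<F>" "internal_algebra U \<Omega> \<G>"
    using spaces by (simp_all add: internal_prob_space_def)
  obtain k1 f where f1: "f \<in> elts (imem U) (star U (Pfin_code k1))" "icode U ` \<F> = elts (imem U) f"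
    using assms(2) by (auto simp: hyperfinite_prob_space_def hyperfinite_def Pfin_code_def elts_def)
  obtain k2 g where g1: "g \<in> elts (imem U) (star U (Pfin_code k2))" "icode U ` \<G> = elts (imem U) g"
    using assms(3) by (auto simp: hyperfinite_prob_space_def hyperfinite_def Pfin_code_def elts_def)
  \<comment> \<open>One level for both algebras, as the transferred formula bounds both by the same set.\<close>
  define k where "k = max k1 k2"
  have f: "f \<in> elts (imem U) (star U (Pfin_code k))" and g: "g \<in> elts (imem U) (star U (Pfin_code k))"
    using f1(1) g1(1) Pfin_mono[of k1 k] Pfin_mono[of k2 k] by (auto simp: k_def)
  define w where "w = icode U \<Omega>"
  note fc = internal_algebra_code[OF algs(1) f1(2), folded w_def]
  note gc = internal_algebra_code[OF algs(2) g1(2), folded w_def]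
  have wf: "w \<in> elts (imem U) f" using fc(1) by (simp add: ns.alg_code_def)
  define n where "n = icode U {ipair U (icode U A) (\<nu> A) | A. A \<in> \<G>}"
  have n: "elts (imem U) n = {ipair U (icode U A) (\<nu> A) | A. A \<in> \<G>}"
    using spaces(2) unfolding internal_prob_space_def internal_probability_def internal_iff_code n_def
    by blast
  note meas = G.measure_code_graph[OF g1(2) n]
  obtain h m where h: "h \<in> elts (imem U) (star U (Pfin_code k))" and m: "m \<in> elts (imem U) g"
    and gen: "ns.generated_code (star U (Pfin_code k)) f g w h"
    and exc: "ns.exceptional_code (star U reals_code) (star U le_code) (star U add_code) f g n h m"
    using internal_merge[OF f g wf fc(1) gc(1) meas(1)] by blast
  have h_alg: "h \<notin> iatoms U" "ns.alg_code w h" "elts (imem U) f \<subseteq> elts (imem U) h"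
    "elts (imem U) g \<subseteq> elts (imem U) h"
    using Pfin_not_atom[OF h] gen by (auto simp: ns.generated_code_def)
  have H: "\<H> = ns.fam h"
    using generated_code_eq[OF h gen] assms(5) by (simp add: fc(2,3) gc(2))
  have H_alg: "internal_algebra U \<Omega> \<H>" "icode U ` \<H> = elts (imem U) h"
    using alg_code_internal[OF h_alg(2,1)] by (simp_all add: H fc(3))
  note hc = internal_algebra_code[OF H_alg, folded w_def]
  have sub: "\<G> \<subseteq> \<H>" using h_alg(4) unfolding H gc(2)[symmetric] by (auto simp: ns.fam_def)
  define N where "N = elts (imem U) m"
  have N: "N \<in> \<G>" using m gc(2) by (auto simp: N_def ns.fam_def)
  have HN: "C - N \<in> \<G>" if C: "C \<in> \<H>" for C
  proof -
    obtain c where "c \<in> elts (imem U) h" "C = elts (imem U) c" using C by (auto simp: H ns.fam_def)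
    then obtain d where "d \<in> elts (imem U) g" "elts (imem U) d = C - N"
      using exc by (auto simp: ns.exceptional_code_def N_def)
    then show ?thesis using gc(2) by (auto simp: ns.fam_def)
  qed
  \<comment> \<open>Loeb measurability of the members of \<open>\<F>\<close> with respect to \<open>\<nu>\<close> enters here, through its
     consequence for standard error bounds.\<close>
  have null_le: "G.st_mu N \<le> 2 * e" if e: "e > 0" for e
  proof -
    have "ns.approx_code (star U reals_code) (star U le_code) f g n (hreal U e)"
      unfolding ns.approx_code_def
    proof
      fix a assume a: "a \<in> elts (imem U) f"
      then have "elts (imem U) a \<in> \<F>" using fc(2) by (auto simp: ns.fam_def)
      then have "elts (imem U) a \<in> loeb_sets U \<Omega> \<G> \<nu>"
        using F.sets_subset_loeb_sets assms(4) by (simp add: loeb_equivalent_def)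
      from G.loeb_sets_approx[OF this e] obtain C C' where C: "C \<in> \<G>" "C' \<in> \<G>"
        "C \<subseteq> elts (imem U) a" "elts (imem U) a \<subseteq> C'" "G.st_mu (C' - C) < e" by blast
      have D: "C' - C \<in> \<G>" using C by auto
      have code: "icode U A \<in> elts (imem U) g" "elts (imem U) (icode U A) = A" if "A \<in> \<G>" for A
        using that g1(2) gc(4) by auto
      \<comment> \<open>The slack between the standard part and \<open>e\<close> turns the strict standard inequality into an
         inequality between hyperreals.\<close>
      have "hle U (\<nu> (C' - C)) (hreal U (G.st_mu (C' - C) + (e - G.st_mu (C' - C))))"
        by (rule st_bounds[OF G.mu_unit[OF D]]) (use C in simp)
      then have "hle U (\<nu> (C' - C)) (hreal U e)" by simp
      then show "\<exists>b\<in>elts (imem U) g. \<exists>b'\<in>elts (imem U) g. \<exists>d\<in>elts (imem U) g.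
          elts (imem U) b \<subseteq> elts (imem U) a \<and> elts (imem U) a \<subseteq> elts (imem U) b' \<and>
          elts (imem U) d = elts (imem U) b' - elts (imem U) b \<and>
          (\<exists>r\<in>elts (imem U) (star U reals_code). ipair U d r \<in> elts (imem U) n \<and>
            ipair U r (hreal U e) \<in> elts (imem U) (star U le_code))"
        using C G.mu_unit(1)[OF D]
        by (intro bexI[OF _ code(1)[OF C(1)]] bexI[OF _ code(1)[OF C(2)]] bexI[OF _ code(1)[OF D]])
          (simp add: code D meas(2)[OF code(1)[OF D]] hle_iff)
    qed
    moreover have "ipair U (ipair U (hreal U e) (hreal U e)) (hreal U (e + e))
        \<in> elts (imem U) (star U add_code)"
      by (subst hadd_iff[symmetric]) simp_all
    moreover have "ipair U m (\<nu> N) \<in> elts (imem U) n" using meas(2)[OF m] by (simp add: N_def)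
    ultimately have "hle U (\<nu> N) (hreal U (e + e))"
      using exc G.mu_unit(1)[OF N] unfolding ns.exceptional_code_def hle_iff elts_star_reals_code
      by (meson hreal_in)
    then show ?thesis using st_le[OF G.mu_unit(1,2)[OF N]] by simp
  qed
  have null: "G.st_mu N = 0"
  proof (rule antisym)
    show "G.st_mu N \<le> 0"
    proof (rule field_le_epsilon)
      fix e :: real assume "e > 0"
      then show "G.st_mu N \<le> 0 + e" using null_le[of "e / 2"] by simp
    qed
  qed (rule G.st_mu_nonneg[OF N])
  \<comment> \<open>\<open>T\<close> gives the whole of \<open>N\<close> to the sets that contain \<open>x\<close>, so that \<open>P\<close> has total mass 1.\<close>
  obtain x where x: "x \<in> \<Omega>" using G.space_nonempty by blast
  define T where "T C = (if x \<in> C then C \<union> N else C - N)" for C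
  define P where "P C = \<nu> (T C)" for C
  have T: "T C \<in> \<G>" if "C \<in> \<H>" for C
  proof -
    have "C \<union> N = (C - N) \<union> N" by auto
    then have "C \<union> N \<in> \<G>" using G.Un[OF HN[OF that] N] by simp
    then show ?thesis using HN[OF that] by (simp add: T_def)
  qed
  have graph: "internal U {ipair U (icode U A) (P A) | A. A \<in> \<H>}"
  proof -
    obtain q where q: "q \<notin> iatoms U" "elts (imem U) q = {ipair U c r | c d r.
      c \<in> elts (imem U) h \<and> d \<in> elts (imem U) g \<and> r \<in> hyperreals U \<and>
      ipair U d r \<in> elts (imem U) n \<and>
      (x \<in> elts (imem U) c \<and> elts (imem U) d = elts (imem U) c \<union> elts (imem U) m \<or>
       x \<notin> elts (imem U) c \<and> elts (imem U) d = elts (imem U) c - elts (imem U) m)}"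
      using internal_graph[OF h g, of n x m] by blast
    have rel: "x \<in> C \<and> elts (imem U) d = C \<union> elts (imem U) m \<or>
       x \<notin> C \<and> elts (imem U) d = C - elts (imem U) m \<longleftrightarrow> elts (imem U) d = T C" for C d
      by (auto simp: T_def N_def)
    have "elts (imem U) q = {ipair U (icode U A) (P A) | A. A \<in> \<H>}" (is "_ = ?R")
    proof
      show "elts (imem U) q \<subseteq> ?R"
      proof
        fix p assume "p \<in> elts (imem U) q"
        then obtain c d r where p: "p = ipair U c r" "c \<in> elts (imem U) h" "d \<in> elts (imem U) g"
          "ipair U d r \<in> elts (imem U) n" "elts (imem U) d = T (elts (imem U) c)"
          unfolding q(2) rel by blast
        then have "P (elts (imem U) c) = r" using meas(2) by (simp add: P_def)
        moreover have "icode U (elts (imem U) c) = c" using ns.alg_code_unique[OF h_alg(2) p(2)] by simp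
        moreover have "elts (imem U) c \<in> \<H>" using p(2) by (simp add: H ns.fam_def)
        ultimately show "p \<in> ?R"
          using p(1) by (intro CollectI exI[of _ "elts (imem U) c"]) simp
      qed
      show "?R \<subseteq> elts (imem U) q"
      proof
        fix p assume "p \<in> ?R"
        then obtain A where A: "p = ipair U (icode U A) (P A)" "A \<in> \<H>" by blast
        have c: "icode U A \<in> elts (imem U) h" "elts (imem U) (icode U A) = A"
          using A(2) H_alg(2) hc(4) by auto
        have d: "icode U (T A) \<in> elts (imem U) g" "elts (imem U) (icode U (T A)) = T A"
          using T[OF A(2)] g1(2) gc(4) by auto
        have "ipair U (icode U (T A)) (P A) \<in> elts (imem U) n"
          using meas(2)[OF d(1)] d(2) by (simp add: P_def)
        moreover have "P A \<in> hyperreals U" unfolding P_def by (rule G.mu_unit(1)[OF T[OF A(2)]])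
        ultimately show "p \<in> elts (imem U) q"
          unfolding q(2) rel using A(1) c d
          by (intro CollectI exI[of _ "icode U A"] exI[of _ "icode U (T A)"] exI[of _ "P A"]) simp
      qed
    qed
    then show ?thesis using q(1) by (auto simp: internal_def)
  qed
  have prob: "internal_probability U \<Omega> \<H> P"
    unfolding internal_probability_def
  proof (intro conjI ballI impI graph)
    fix A assume "A \<in> \<H>"
    then show "P A \<in> hyperreals U" "hle U (hreal U 0) (P A)" "hle U (P A) (hreal U 1)"
      unfolding P_def by (auto intro: G.mu_unit T)
  next
    have "T \<Omega> = \<Omega>" using x G.sets_into_space[OF N] by (auto simp: T_def)
    then show "P \<Omega> = hreal U 1" by (simp add: P_def G.mu_top)
  next
    fix A B assume AB: "A \<in> \<H>" "B \<in> \<H>" "A \<inter> B = {}"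
    have "T (A \<union> B) = T A \<union> T B" "T A \<inter> T B = {}" using AB(3) by (auto simp: T_def)
    then show "P (A \<union> B) = hadd U (P A) (P B)"
      using G.mu_add[OF T[OF AB(1)] T[OF AB(2)]] by (simp add: P_def)
  qed
  then have hyp: "hyperfinite_prob_space U \<Omega> \<H> P"
    using H_alg h by (auto simp: hyperfinite_prob_space_def internal_prob_space_def hyperfinite_def
      Pfin_code_def elts_def)
  then have H_prob: "internal_prob U \<Omega> \<H> P"
    by unfold_locales (simp add: hyperfinite_prob_space_def)
  have P_st: "st U (P C) = G.st_mu (C - N)" if C: "C \<in> \<H>" for C
  proof -
    have "C \<union> N = (C - N) \<union> N" by auto
    then show ?thesis
      using G.st_mu_add[OF HN[OF C] N] null by (auto simp: P_def T_def)
  qed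
  note eq = loeb_equal_modulo_null[OF G.internal_prob_axioms H_prob sub N null HN P_st]
  have "loeb_sets U \<Omega> \<H> P = loeb_sets U \<Omega> \<G> \<nu>"
    using eq by (auto simp: loeb_sets_def)
  moreover have "B \<subseteq> \<Omega>" if "B \<in> loeb_sets U \<Omega> \<F> \<mu>" for B
    using that by (simp add: loeb_sets_def)
  ultimately have "loeb_equivalent U \<Omega> \<F> \<mu> \<H> P"
    using assms(4) eq(1) by (simp add: loeb_equivalent_def)
  then show ?thesis using hyp by blast
qed

end
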